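(* Consider the system $$x_i(m+1)=a_i(m)\,x_i(m-\nu_i(m))+\sum_{j=1}^{n}\sum_{p=1}^{P} b_{ijp}(m)\,f_{ijp}\big(x_j(m-\tau_{ijp}(m))\big)+\sum_{j=1}^{n} c_{ij}(m)\sum_{l=0}^{\infty}\zeta_{ijl}\,g_{ij}(x_j(m-l))+I_i(m),\quad i\in\{1,\dots,n\}, \qquad (\ast)$$ with the standing setting given in the context, and assume that for all $i,j\in\{1,\dots,n\}$ and $p\in\{1,\dots,P\}$: (H1) $a_i^+:=\sup_{m\in\mathbb{N}_0}|a_i(m)|<1$; (H2) $\lim_{m\to\infty}(m-\nu_i(m))=\lim_{m\to\infty}(m-\tau_{ijp}(m))=\infty$; (H3) the functions $b_{ijp}$ and $c_{ij}$ are bounded; (H4) $\sum_{l=0}^\infty|\zeta_{ijl}|=1$; (H5) $\sum_{m=0}^\infty|I_i(m)|<\infty$. Let $F_{ijp},G_{ij}>0$ be constants. 1. Suppose that (H6) holds, i.e. for all $i,j\in\{1,\dots,n\}$, $p\in\{1,\dots,P\}$ the functions $f_{ijp},g_{ij}:\mathbb{R}\to\mathbb{R}$ are continuous, $|f_{ijp}(u)|\le F_{ijp}$ and $|g_{ij}(u)|\le G_{ij}$ if $|u|>1$, and $|f_{ijp}(u)|<F_{ijp}|u|$ and $|g_{ij}(u)|<G_{ij}|u|$ if $|u|\le1$ and $u\ne0$. If the matrix $$\hat{\mathcal M}=\mathrm{diag}(1-\hat a_1,\dots,1-\hat a_n)-\Big[\hat c_{ij}G_{ij}+\sum_{p=1}^{P}\hat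 b_{ijp}F_{ijp}\Big]_{i,j=1}^n$$ is an $M$-matrix, then for every $\sigma\in\mathbb{N}_0$ and every $\overline\psi\in\mathcal{B}^n$ the solution $\overline x(\cdot,\sigma,\overline\psi)$ of $(\ast)$ with initial condition $\overline x_\sigma=\overline\psi$ satisfies $\lim_{m\to\infty}|\overline x(m,\sigma,\overline\psi)|=0$. 2. Suppose that (H6* ) holds, i.e. for all $i,j\in\{1,\dots,n\}$, $p\in\{1,\dots,P\}$ the functions $f_{ijp},g_{ij}:\mathbb{R}\to\mathbb{R}$ are continuous and $|f_{ijp}(u)|<F_{ijp}|u|$ and $|g_{ij}(u)|<G_{ij}|u|$ for all $u\neq0$. If the matrix $$\mathcal M^+=\mathrm{diag}(1-a_1^+,\dots,1-a_n^+)-\Big[c_{ij}^+G_{ij}+\sum_{p=1}^{P}b_{ijp}^+F_{ijp}\Big]_{i,j=1}^n$$ is a singular irreducible $M$-matrix, then for every $\sigma\in\mathbb{N}_0$ and every $\overline\psi\in\mathcal{B}^n$ the solution $\overline x(\cdot,\sigma,\overline\psi)$ of $(\ast)$ with initial condition $\overline x_\sigma=\overline\psi$ satisfies $\lim_{m\to\infty}|\overline x(m,\sigma,\overline\psi)|=0$.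
   Context: Setting. $n,P$ are positive integers, $\mathbb{N}_0=\{0,1,2,\dots\}$. For $i,j\in\{1,\dots,n\}$, $p\in\{1,\dots,P\}$, $l\in\mathbb{N}_0$: $\zeta_{ijl}\in\mathbb{R}$, $a_i:\mathbb{N}_0\to(-1,1)$, $\nu_i,\tau_{ijp}:\mathbb{N}_0\to\mathbb{N}_0$, $b_{ijp},c_{ij},I_i:\mathbb{N}_0\to\mathbb{R}$, and $f_{ijp},g_{ij}:\mathbb{R}\to\mathbb{R}$ are functions. Norm. $\mathbb{R}^n$ carries the norm $|(x_1,\dots,x_n)|=\max_i|x_i|$. Initial conditions and solutions. $\mathcal{B}^n$ is the space of bounded functions $\overline\psi:\{s\in\mathbb{Z}:s\le0\}\to\mathbb{R}^n$, with norm $\|\overline\psi\|=\sup_{s\le0}|\overline\psi(s)|$. For $\overline x:\mathbb{Z}\to\mathbb{R}^n$ with $\sup_{s\le 0}|\overline x(s)|<\infty$ and $m\in\mathbb{Z}$, $\overline x_m\in\mathcal{B}^n$ is defined by $\overline x_m(s)=\overline x(m+s)$ for integers $s\le0$. For $\sigma\in\mathbb{N}_0$, $\overline\psi\in\mathcal{B}^n$, $\overline x(\cdot,\sigma,\overline\psi)=(x_1,\dots,x_n)$ denotes the unique solution of the system with $\overline x_\sigma=\overline\psi$ (that is, $\overline x(\sigma+s)=\overline\psi(s)$ for integers $s\le0$, and the system holds for all integers $m\ge\sigma$). Coefficients. $b_{ijp}^+=\sup_{m\in\mathbb{N}_0}|b_{ijp}(m)|$, $c_{ij}^+=\sup_{m\in\mathbb{N}_0}|c_{ij}(m)|$,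 $\hat a_i=\limsup_{m\to\infty}|a_i(m)|$, $\hat b_{ijp}=\limsup_{m\to\infty}|b_{ijp}(m)|$, $\hat c_{ij}=\limsup_{m\to\infty}|c_{ij}(m)|$. Matrices. A real $n\times n$ matrix with all off-diagonal entries $\le0$ is an $M$-matrix if all its principal minors are non-negative (so an $M$-matrix may be singular). A square real matrix $A$ is reducible if there is a permutation matrix $Q$ such that $QAQ^T=\begin{bmatrix}B&0\\C&D\end{bmatrix}$ with $B,D$ square, or if $n=1$ and $A=[0]$; otherwise it is irreducible. *)

theory Defs
  imports
    Complex_Main
    "HOL-Library.Extended_Real"
    "HOL-Library.Liminf_Limsup"
    "Jordan_Normal_Form.Determinant"
    "Jordan_Normal_Form.DL_Submatrix"
begin

text \<open>Vectors, matrices and all index families are indexed from 0: indices \<open>i, j < n\<close> and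
  \<open>p < P\<close> stand for \<open>1, \<dots>, n\<close> and \<open>1, \<dots>, P\<close>.\<close>

definition Z_matrix :: "real mat \<Rightarrow> bool" where
  "Z_matrix A \<longleftrightarrow> square_mat A \<and>
     (\<forall>i<dim_row A. \<forall>j<dim_row A. i \<noteq> j \<longrightarrow> A $$ (i, j) \<le> 0)"

definition M_matrix :: "real mat \<Rightarrow> bool" where
  "M_matrix A \<longleftrightarrow> Z_matrix A \<and>
     (\<forall>J. J \<subseteq> {0..<dim_row A} \<and> J \<noteq> {} \<longrightarrow> 0 \<le> det (submatrix A J J))"

definition permutation_matrix :: "nat \<Rightarrow> real mat \<Rightarrow> bool" where
  "permutation_matrix n Q \<longleftrightarrow>
     (\<exists>\<pi>. \<pi> permutes {0..<n} \<and> Q = mat n n (\<lambda>(i, j). if j = \<pi> i then 1 else 0))"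

text \<open>The diagonal blocks have to be non-empty, since otherwise every matrix would be reducible.\<close>

definition reducible_matrix :: "real mat \<Rightarrow> bool" where
  "reducible_matrix A \<longleftrightarrow>
     (\<exists>n Q. A \<in> carrier_mat n n \<and> permutation_matrix n Q \<and>
        (\<exists>k l B C D. 0 < k \<and> 0 < l \<and>
           B \<in> carrier_mat k k \<and> C \<in> carrier_mat l k \<and> D \<in> carrier_mat l l \<and>
           Q * A * transpose_mat Q = four_block_mat B (0\<^sub>m k l) C D))
     \<or> A = 0\<^sub>m 1 1"

definition irreducible_matrix :: "real mat \<Rightarrow> bool" where
  "irreducible_matrix A \<longleftrightarrow> square_mat A \<and> \<not> reducible_matrix A"

definition singular_matrix :: "real mat \<Rightarrow> bool" where
  "singular_matrix A \<longleftrightarrow> square_mat A \<and> det A = 0"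

text \<open>Both of the following are only meaningful for bounded sequences. The upper limit is taken in the extended
  reals because the real numbers are not a complete lattice.\<close>

definition abs_sup :: "(nat \<Rightarrow> real) \<Rightarrow> real" where
  "abs_sup u = (SUP m. \<bar>u m\<bar>)"

definition abs_limsup :: "(nat \<Rightarrow> real) \<Rightarrow> real" where
  "abs_limsup u = real_of_ereal (limsup (\<lambda>m. ereal \<bar>u m\<bar>))"

definition sublinear_capped :: "(real \<Rightarrow> real) \<Rightarrow> real \<Rightarrow> bool" where
  "sublinear_capped h K \<longleftrightarrow> continuous_on UNIV h \<and>
     (\<forall>u. \<bar>u\<bar> > 1 \<longrightarrow> \<bar>h u\<bar> \<le> K) \<and>
     (\<forall>u. \<bar>u\<bar> \<le> 1 \<and> u \<noteq> 0 \<longrightarrow> \<bar>h u\<bar> < K * \<bar>u\<bar>)"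

definition sublinear :: "(real \<Rightarrow> real) \<Rightarrow> real \<Rightarrow> bool" where
  "sublinear h K \<longleftrightarrow> continuous_on UNIV h \<and> (\<forall>u. u \<noteq> 0 \<longrightarrow> \<bar>h u\<bar> < K * \<bar>u\<bar>)"

text \<open>Unspecified (\<open>Max {}\<close>) in dimension 0.\<close>

definition max_norm :: "real vec \<Rightarrow> real" where
  "max_norm v = Max ((\<lambda>i. \<bar>v $ i\<bar>) ` {0..<dim_vec v})"

text \<open>Initial functions are total on \<^typ>\<open>int\<close>; only their values on the non-positive
  integers are ever used.\<close>

definition bounded_initial :: "nat \<Rightarrow> (int \<Rightarrow> real vec) set" where
  "bounded_initial n = {\<psi>. (\<forall>s\<le>0. \<psi> s \<in> carrier_vec n) \<and> bdd_above ((\<lambda>s. max_norm (\<psi> s)) ` {..0})}"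

text \<open>The index order is that of the mathematical notation: \<open>\<tau> i j p m\<close>, \<open>b i j p m\<close>, \<open>c i j m\<close>,
  \<open>\<zeta> i j l\<close>, \<open>a i m\<close>. For bounded history, \<open>\<zeta> i j\<close> absolutely summable and \<open>g i j\<close> continuous,
  the series converges absolutely.\<close>

definition system_rhs ::
  "nat \<Rightarrow> nat \<Rightarrow> (nat \<Rightarrow> nat \<Rightarrow> real) \<Rightarrow> (nat \<Rightarrow> nat \<Rightarrow> nat) \<Rightarrow>
   (nat \<Rightarrow> nat \<Rightarrow> nat \<Rightarrow> nat \<Rightarrow> real) \<Rightarrow> (nat \<Rightarrow> nat \<Rightarrow> nat \<Rightarrow> nat \<Rightarrow> nat) \<Rightarrow>
   (nat \<Rightarrow> nat \<Rightarrow> nat \<Rightarrow> real \<Rightarrow> real) \<Rightarrow> (nat \<Rightarrow> nat \<Rightarrow> nat \<Rightarrow> real) \<Rightarrow>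
   (nat \<Rightarrow> nat \<Rightarrow> nat \<Rightarrow> real) \<Rightarrow> (nat \<Rightarrow> nat \<Rightarrow> real \<Rightarrow> real) \<Rightarrow> (nat \<Rightarrow> nat \<Rightarrow> real) \<Rightarrow>
   (int \<Rightarrow> real vec) \<Rightarrow> nat \<Rightarrow> nat \<Rightarrow> real" where
  "system_rhs n P a \<nu> b \<tau> f c \<zeta> g I x m i =
     a i m * x (int m - int (\<nu> i m)) $ i
     + (\<Sum>j<n. \<Sum>p<P. b i j p m * f i j p (x (int m - int (\<tau> i j p m)) $ j))
     + (\<Sum>j<n. c i j m * (\<Sum>l. \<zeta> i j l * g i j (x (int m - int l) $ j)))
     + I i m"

definition is_solution ::
  "nat \<Rightarrow> nat \<Rightarrow> (nat \<Rightarrow> nat \<Rightarrow> real) \<Rightarrow> (nat \<Rightarrow> nat \<Rightarrow> nat) \<Rightarrow>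
   (nat \<Rightarrow> nat \<Rightarrow> nat \<Rightarrow> nat \<Rightarrow> real) \<Rightarrow> (nat \<Rightarrow> nat \<Rightarrow> nat \<Rightarrow> nat \<Rightarrow> nat) \<Rightarrow>
   (nat \<Rightarrow> nat \<Rightarrow> nat \<Rightarrow> real \<Rightarrow> real) \<Rightarrow> (nat \<Rightarrow> nat \<Rightarrow> nat \<Rightarrow> real) \<Rightarrow>
   (nat \<Rightarrow> nat \<Rightarrow> nat \<Rightarrow> real) \<Rightarrow> (nat \<Rightarrow> nat \<Rightarrow> real \<Rightarrow> real) \<Rightarrow> (nat \<Rightarrow> nat \<Rightarrow> real) \<Rightarrow>
   nat \<Rightarrow> (int \<Rightarrow> real vec) \<Rightarrow> (int \<Rightarrow> real vec) \<Rightarrow> bool" where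
  "is_solution n P a \<nu> b \<tau> f c \<zeta> g I \<sigma> \<psi> x \<longleftrightarrow>
     (\<forall>m. x m \<in> carrier_vec n) \<and>
     (\<forall>s\<le>0. x (int \<sigma> + s) = \<psi> s) \<and>
     (\<forall>m\<ge>\<sigma>. \<forall>i<n. x (int m + 1) $ i = system_rhs n P a \<nu> b \<tau> f c \<zeta> g I x m i)"

lemma system_rhs_cong:
  assumes "\<And>k. k \<le> int m \<Longrightarrow> x k = y k"
  shows "system_rhs n P a \<nu> b \<tau> f c \<zeta> g I x m i = system_rhs n P a \<nu> b \<tau> f c \<zeta> g I y m i"
  unfolding system_rhs_def by (simp add: assms)

text \<open>Hence a statement about every solution is one about the solution.\<close>

lemma solution_ex1:
  assumes "\<psi> \<in> bounded_initial n"
  shows "\<exists>!x. is_solution n P a \<nu> b \<tau> f c \<zeta> g I \<sigma> \<psi> x"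
proof -
  let ?R = "system_rhs n P a \<nu> b \<tau> f c \<zeta> g I"
  have \<psi>: "\<psi> s \<in> carrier_vec n" if "s \<le> 0" for s
    using assms that by (auto simp: bounded_initial_def)
  define X where "X = rec_nat (\<lambda>m. if m \<le> int \<sigma> then \<psi> (m - int \<sigma>) else 0\<^sub>v n)
    (\<lambda>k y. y(int (\<sigma> + k) + 1 := vec n (?R y (\<sigma> + k))))"
  have X0: "X 0 = (\<lambda>m. if m \<le> int \<sigma> then \<psi> (m - int \<sigma>) else 0\<^sub>v n)"
    and XS: "X (Suc k) = (X k)(int (\<sigma> + k) + 1 := vec n (?R (X k) (\<sigma> + k)))" for k
    by (simp_all add: X_def)
  have stab: "X (k + d) m = X k m" if "m \<le> int (\<sigma> + k)" for k d m
    using that by (induction d) (auto simp: XS)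
  define x where "x = (\<lambda>m. X (nat (m - int \<sigma>)) m)"
  have xX: "x m = X k m" if "m \<le> int (\<sigma> + k)" for m k
  proof -
    have "nat (m - int \<sigma>) \<le> k" using that by simp
    then obtain d where d: "k = nat (m - int \<sigma>) + d" using le_Suc_ex by blast
    show ?thesis unfolding x_def d by (rule stab[symmetric]) simp
  qed
  have carX: "X k m \<in> carrier_vec n" for k m
    by (induction k arbitrary: m) (auto simp: X0 XS \<psi>)
  have "x (int m + 1) $ i = ?R x m i" if "\<sigma> \<le> m" "i < n" for m i
  proof -
    obtain k where k: "m = \<sigma> + k" using \<open>\<sigma> \<le> m\<close> le_Suc_ex by blast
    have "x (int m + 1) = X (Suc k) (int m + 1)" by (rule xX) (simp add: k)
    also have "\<dots> = vec n (?R (X k) m)" by (simp add: XS k)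
    finally have "x (int m + 1) $ i = ?R (X k) m i" using that by simp
    also have "\<dots> = ?R x m i" by (rule system_rhs_cong) (simp add: xX[symmetric] k)
    finally show ?thesis .
  qed
  moreover have "x (int \<sigma> + s) = \<psi> s" if "s \<le> 0" for s
    using that xX[of "int \<sigma> + s" 0] by (simp add: X0)
  ultimately have ex: "is_solution n P a \<nu> b \<tau> f c \<zeta> g I \<sigma> \<psi> x"
    using carX by (simp add: is_solution_def x_def)
  have uniq: "y = z"
    if y: "is_solution n P a \<nu> b \<tau> f c \<zeta> g I \<sigma> \<psi> y"
    and z: "is_solution n P a \<nu> b \<tau> f c \<zeta> g I \<sigma> \<psi> z" for y z
  proof -
    have eq: "\<forall>m \<le> int (\<sigma> + k). y m = z m" for k
    proof (induction k)
      case 0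
      show ?case
      proof (intro allI impI)
        fix m assume "m \<le> int (\<sigma> + 0)"
        then show "y m = z m"
          using y z unfolding is_solution_def
          by (metis add.right_neutral add_diff_cancel_left' diff_add_cancel add.commute
              diff_le_0_iff_le)
      qed
    next
      case (Suc k)
      have "y (int (\<sigma> + k) + 1) = z (int (\<sigma> + k) + 1)"
      proof (rule eq_vecI)
        have yc: "y (int (\<sigma> + k) + 1) \<in> carrier_vec n" and zc: "z (int (\<sigma> + k) + 1) \<in> carrier_vec n"
          using y z by (auto simp: is_solution_def)
        then show "dim_vec (y (int (\<sigma> + k) + 1)) = dim_vec (z (int (\<sigma> + k) + 1))" by auto
        fix i assume "i < dim_vec (z (int (\<sigma> + k) + 1))"
        then have i: "i < n" using zc by auto
        have "?R y (\<sigma> + k) i = ?R z (\<sigma> + k) i"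
          by (rule system_rhs_cong) (use Suc in auto)
        then show "y (int (\<sigma> + k) + 1) $ i = z (int (\<sigma> + k) + 1) $ i"
          using y z i unfolding is_solution_def by (metis le_add1)
      qed
      then show ?case using Suc
        by (metis add.commute int_Suc add_Suc_right zle_add1_eq_le order_le_less)
    qed
    show ?thesis
    proof
      fix m
      have "m \<le> int (\<sigma> + nat m)" by simp
      then show "y m = z m" using eq by blast
    qed
  qed
  show ?thesis using ex uniq by blast
qed

end

theory Submission
  imports Defs
begin

text \<open>Let \<open>L\<^sub>i\<close> be the upper limit of \<open>\<bar>x\<^sub>i\<bar>\<close>. Once the solution is known to be bounded, passing to upper limits in the
  system and using the strict sublinearity of the nonlinearities gives \<open>(M L)\<^sub>i < 0\<close> for every \<open>i\<close> in
  the support \<open>S\<close> of \<open>L\<close>, where only the entries in \<open>S \<times> S\<close> of the comparison matrix \<open>M\<close> matter. If \<open>S\<close> were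
  non-empty, one could add positive numbers to the diagonal of the principal submatrix of \<open>M\<close> on \<open>S\<close> so that \<open>L\<close>
  lies in its kernel; but the determinant after this change is a sum of non-negative multiples of principal
  minors of \<open>M\<close>, one of which is positive. Hence \<open>L = 0\<close>.

  Boundedness is immediate for bounded nonlinearities. In the second part it follows from a positive
  vector \<open>d\<close> with \<open>M d \<ge> 0\<close>, since \<open>\<bar>x\<^sub>i\<bar> \<le> d\<^sub>i V\<close> is then preserved up to the summable inputs. Such a \<open>d\<close> is a
  limit of normalised solutions of \<open>(M + \<epsilon> 1) d = 1\<close>, and irreducibility makes it positive.\<close>

section \<open>Principal minors\<close>

text \<open>Leibniz formula over the permutations of the index set \<open>S\<close> itself. Without
  renumbering to \<open>{0..<k}\<close>, complements such as \<open>S - T\<close> can be treated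
  directly.\<close>

definition minor :: "(nat \<Rightarrow> nat \<Rightarrow> real) \<Rightarrow> nat set \<Rightarrow> real" where
  "minor A S = (\<Sum>\<pi>\<in>{\<pi>. \<pi> permutes S}. of_int (sign \<pi>) * (\<Prod>i\<in>S. A i (\<pi> i)))"

lemma minor_cong:
  assumes "\<And>i j. i \<in> S \<Longrightarrow> j \<in> S \<Longrightarrow> A i j = B i j"
  shows "minor A S = minor B S"
  unfolding minor_def
  by (intro sum.cong refl arg_cong2[where f = "(*)"] prod.cong assms) (auto simp: permutes_in_image)

lemma minor_empty [simp]: "minor A {} = 1"
  by (simp add: minor_def sign_id[unfolded id_def] sign_id)

text \<open>Conjugation by \<open>e\<close> is a sign-preserving bijection from the permutations of
  \<open>{0..<k}\<close> to those of \<open>S\<close>. Any enumeration of \<open>S\<close> may be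
  used, not only the increasing one.\<close>

lemma minor_eq_det:
  assumes e: "bij_betw e {0..<k} S"
  shows "minor A S = det (mat k k (\<lambda>(i, j). A (e i) (e j)))"
proof -
  have inj: "inj_on e {0..<k}" using e by (simp add: bij_betw_def)
  have "minor A S = (\<Sum>\<pi>\<in>{\<pi>. \<pi> permutes {0..<k}}.
      of_int (sign (map_permutation {0..<k} e \<pi>)) * (\<Prod>i\<in>S. A i (map_permutation {0..<k} e \<pi> i)))"
    unfolding minor_def
  proof (rule sum.reindex_bij_betw[symmetric])
    \<comment> \<open>\<open>bij_betw_permutations\<close> speaks of an explicit conjugation by
      \<open>e\<close>, so \<open>map_permutation\<close> is first brought into that form.\<close>
    have "map_permutation {0..<k} e = (\<lambda>\<pi> x. if x \<in> S then e (\<pi> (inv_into {0..<k} e x)) else x)"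
      using e by (intro ext) (simp add: map_permutation_def restrict_id_def bij_betw_def)
    then show "bij_betw (map_permutation {0..<k} e) {\<pi>. \<pi> permutes {0..<k}} {\<pi>. \<pi> permutes S}"
      using bij_betw_permutations[OF e] by (simp only:)
  qed
  also have "\<dots> = (\<Sum>\<pi>\<in>{\<pi>. \<pi> permutes {0..<k}}.
      of_int (sign \<pi>) * (\<Prod>i = 0..<k. mat k k (\<lambda>(i, j). A (e i) (e j)) $$ (i, \<pi> i)))"
  proof (rule sum.cong[OF refl])
    fix \<pi> assume "\<pi> \<in> {\<pi>. \<pi> permutes {0..<k}}"
    then have \<pi>: "\<pi> permutes {0..<k}" by simp
    have "(\<Prod>i\<in>S. A i (map_permutation {0..<k} e \<pi> i))
        = (\<Prod>i = 0..<k. A (e i) (map_permutation {0..<k} e \<pi> (e i)))"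
      by (rule prod.reindex_bij_betw[OF e, symmetric])
    also have "\<dots> = (\<Prod>i = 0..<k. mat k k (\<lambda>(i, j). A (e i) (e j)) $$ (i, \<pi> i))"
    proof (rule prod.cong[OF refl])
      fix i assume "i \<in> {0..<k}"
      then show "A (e i) (map_permutation {0..<k} e \<pi> (e i)) = mat k k (\<lambda>(i, j). A (e i) (e j)) $$ (i, \<pi> i)"
        using permutes_in_image[OF \<pi>, of i] by (simp add: map_permutation_apply[OF inj])
    qed
    finally show "of_int (sign (map_permutation {0..<k} e \<pi>)) * (\<Prod>i\<in>S. A i (map_permutation {0..<k} e \<pi> i))
      = of_int (sign \<pi>) * (\<Prod>i = 0..<k. mat k k (\<lambda>(i, j). A (e i) (e j)) $$ (i, \<pi> i))"
      by (simp add: sign_map_permutation[OF inj \<pi>])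
  qed
  also have "\<dots> = det (mat k k (\<lambda>(i, j). A (e i) (e j)))"
    by (simp add: det_def)
  finally show ?thesis .
qed

text \<open>An element of \<open>S\<close> is picked at the index that counts the smaller elements
  of \<open>S\<close>, which gives surjectivity; injectivity then follows by cardinality.\<close>

lemma bij_betw_pick:
  assumes "finite S"
  shows "bij_betw (pick S) {0..<card S} S"
proof -
  have "S \<subseteq> pick S ` {0..<card S}"
  proof
    fix i assume i: "i \<in> S"
    then have "card {a \<in> S. a < i} < card S"
      using assms by (intro psubset_card_mono) auto
    with i show "i \<in> pick S ` {0..<card S}"
      by (auto intro!: image_eqI[of _ _ "card {a \<in> S. a < i}"] simp del: pick.simps simp: pick_card_in_set)
  qed
  moreover have "card (pick S ` {0..<card S}) \<le> card S"
    using card_image_le[of "{0..<card S}" "pick S"] by simp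
  ultimately have "pick S ` {0..<card S} = S"
    by (intro card_seteq[symmetric]) auto
  then show ?thesis
    by (auto simp: bij_betw_def intro!: eq_card_imp_inj_on)
qed

lemma det_submatrix_eq_minor:
  assumes "A \<in> carrier_mat n n" "S \<subseteq> {0..<n}"
  shows "det (submatrix A S S) = minor (\<lambda>i j. A $$ (i, j)) S"
proof -
  have "{i. i < n \<and> i \<in> S} = S" using assms(2) by auto
  then have "submatrix A S S = mat (card S) (card S) (\<lambda>(i, j). A $$ (pick S i, pick S j))"
    using assms(1) by (simp only: submatrix_def carrier_matD[OF assms(1)])
  then show ?thesis
    using minor_eq_det[OF bij_betw_pick[OF finite_subset[OF assms(2)]], of "\<lambda>i j. A $$ (i, j)"]
    by (simp only: finite_atLeastLessThan)
qed

text \<open>Expanding each product over \<open>S\<close>, let \<open>T\<close> be the set of factors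
  from which the diagonal summand is chosen. Only permutations fixing \<open>T\<close> pointwise
  survive, and these are the permutations of \<open>S - T\<close>.\<close>

lemma minor_add_diag:
  fixes A :: "nat \<Rightarrow> nat \<Rightarrow> real"
  assumes S: "finite S"
  shows "minor (\<lambda>i j. (if i = j then \<delta> i else 0) + A i j) S
    = (\<Sum>T\<in>Pow S. (\<Prod>i\<in>T. \<delta> i) * minor A (S - T))"
proof -
  let ?D = "\<lambda>\<pi> T. \<Prod>i\<in>T. if i = \<pi> i then \<delta> i else 0"
  have fix_T: "(\<Sum>\<pi> | \<pi> permutes S. of_int (sign \<pi>) * (?D \<pi> T * (\<Prod>i\<in>S - T. A i (\<pi> i))))
      = (\<Prod>i\<in>T. \<delta> i) * minor A (S - T)" if T: "T \<in> Pow S" for T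
  proof -
    have "finite T" using S T by (auto intro: finite_subset)
    have "(\<Sum>\<pi> | \<pi> permutes S. of_int (sign \<pi>) * (?D \<pi> T * (\<Prod>i\<in>S - T. A i (\<pi> i))))
      = (\<Sum>\<pi> | \<pi> permutes (S - T). of_int (sign \<pi>) * (?D \<pi> T * (\<Prod>i\<in>S - T. A i (\<pi> i))))"
    proof (rule sum.mono_neutral_right)
      show "finite {\<pi>. \<pi> permutes S}" by (rule finite_permutations[OF S])
      show "{\<pi>. \<pi> permutes (S - T)} \<subseteq> {\<pi>. \<pi> permutes S}"
        by (auto intro: permutes_subset)
      show "\<forall>\<pi>\<in>{\<pi>. \<pi> permutes S} - {\<pi>. \<pi> permutes (S - T)}.
          of_int (sign \<pi>) * (?D \<pi> T * (\<Prod>i\<in>S - T. A i (\<pi> i))) = 0"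
      proof
        \<comment> \<open>Such a permutation moves a point of \<open>T\<close>, where the diagonal
          factor is 0.\<close>
        fix \<pi> assume "\<pi> \<in> {\<pi>. \<pi> permutes S} - {\<pi>. \<pi> permutes (S - T)}"
        then obtain x where "x \<in> T" "\<pi> x \<noteq> x"
          using permutes_superset[of \<pi> S "S - T"] by auto
        then have "?D \<pi> T = 0"
          using \<open>finite T\<close> by (intro prod_zero bexI[of _ x]) auto
        then show "of_int (sign \<pi>) * (?D \<pi> T * (\<Prod>i\<in>S - T. A i (\<pi> i))) = 0" by simp
      qed
    qed
    also have "\<dots> = (\<Sum>\<pi> | \<pi> permutes (S - T). (\<Prod>i\<in>T. \<delta> i) * (of_int (sign \<pi>) * (\<Prod>i\<in>S - T. A i (\<pi> i))))"
    proof (rule sum.cong[OF refl])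
      fix \<pi> assume "\<pi> \<in> {\<pi>. \<pi> permutes (S - T)}"
      then have "?D \<pi> T = (\<Prod>i\<in>T. \<delta> i)"
        by (intro prod.cong refl) (auto simp: permutes_def)
      then show "of_int (sign \<pi>) * (?D \<pi> T * (\<Prod>i\<in>S - T. A i (\<pi> i)))
        = (\<Prod>i\<in>T. \<delta> i) * (of_int (sign \<pi>) * (\<Prod>i\<in>S - T. A i (\<pi> i)))" by simp
    qed
    finally show ?thesis by (simp add: minor_def sum_distrib_left)
  qed
  have "minor (\<lambda>i j. (if i = j then \<delta> i else 0) + A i j) S
    = (\<Sum>\<pi> | \<pi> permutes S. \<Sum>T\<in>Pow S. of_int (sign \<pi>) * (?D \<pi> T * (\<Prod>i\<in>S - T. A i (\<pi> i))))"
    by (simp add: minor_def prod_add[OF S] sum_distrib_left)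
  also have "\<dots> = (\<Sum>T\<in>Pow S. \<Sum>\<pi> | \<pi> permutes S. of_int (sign \<pi>) * (?D \<pi> T * (\<Prod>i\<in>S - T. A i (\<pi> i))))"
    by (rule sum.swap)
  finally show ?thesis using fix_T by simp
qed

text \<open>In the expansion over \<open>T\<close> every term is non-negative, and the term
  \<open>T = S\<close> is the product of all \<delta> times the empty minor 1.\<close>

lemma minor_add_diag_pos:
  assumes S: "finite S" and A: "\<And>T. T \<subseteq> S \<Longrightarrow> 0 \<le> minor A T" and \<delta>: "\<And>i. i \<in> S \<Longrightarrow> 0 < \<delta> i"
  shows "0 < minor (\<lambda>i j. (if i = j then \<delta> i else 0) + A i j) S"
proof -
  have "0 \<le> (\<Prod>i\<in>T. \<delta> i) * minor A (S - T)" if "T \<in> Pow S" for T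
    using that \<delta> by (intro mult_nonneg_nonneg prod_nonneg A) (auto intro: less_imp_le)
  moreover have "0 < (\<Prod>i\<in>S. \<delta> i) * minor A (S - S)"
    using \<delta> by (auto intro: prod_pos)
  ultimately show ?thesis
    unfolding minor_add_diag[OF S] using S by (intro sum_pos2[of _ S]) auto
qed

text \<open>The restriction of \<open>y\<close> to \<open>S\<close> is a non-zero kernel vector of
  the principal submatrix.\<close>

lemma minor_eq_0:
  assumes S: "finite S" and i0: "i\<^sub>0 \<in> S" "y i\<^sub>0 \<noteq> 0"
    and ker: "\<And>i. i \<in> S \<Longrightarrow> (\<Sum>j\<in>S. A i j * y j) = 0"
  shows "minor A S = 0"
proof -
  obtain e where e: "bij_betw e {0..<card S} S"
    using ex_bij_betw_nat_finite[OF S] by blast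
  let ?k = "card S"
  let ?M = "mat ?k ?k (\<lambda>(i, j). A (e i) (e j))"
  let ?v = "vec ?k (\<lambda>i. y (e i))"
  have "i\<^sub>0 \<in> e ` {0..<?k}" using e i0 by (simp add: bij_betw_def)
  then obtain k where k: "k < ?k" "i\<^sub>0 = e k" by auto
  have "?v \<noteq> 0\<^sub>v ?k"
    using k i0(2) by (metis index_vec index_zero_vec(1))
  moreover have "?M *\<^sub>v ?v = 0\<^sub>v ?k"
  proof (rule eq_vecI)
    fix i assume i: "i < dim_vec (0\<^sub>v ?k)"
    then have "(?M *\<^sub>v ?v) $ i = (\<Sum>j = 0..<?k. A (e i) (e j) * y (e j))"
      by (simp add: scalar_prod_def)
    also have "\<dots> = (\<Sum>j\<in>S. A (e i) j * y j)"
      by (rule sum.reindex_bij_betw[OF e])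
    also have "\<dots> = 0" using e i by (intro ker) (auto simp: bij_betw_def)
    finally show "(?M *\<^sub>v ?v) $ i = 0\<^sub>v ?k $ i" using i by simp
  qed simp
  ultimately have "det ?M = 0"
    using det_0_iff_vec_prod_zero[of ?M ?k] by (auto intro!: exI[of _ ?v])
  then show ?thesis by (simp add: minor_eq_det[OF e])
qed

text \<open>Increasing the diagonal until \<open>y\<close> lies in the kernel would make a determinant vanish that is positive by
  minor_add_diag_pos.\<close>

lemma nonneg_minors_no_sign_reversal:
  assumes S: "finite S" "S \<noteq> {}" and A: "\<And>T. T \<subseteq> S \<Longrightarrow> 0 \<le> minor A T"
    and y: "\<And>i. i \<in> S \<Longrightarrow> 0 < y i"
  shows "\<exists>i\<in>S. 0 \<le> (\<Sum>j\<in>S. A i j * y j)"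
proof (rule ccontr)
  assume "\<not> ?thesis"
  then have neg: "(\<Sum>j\<in>S. A i j * y j) < 0" if "i \<in> S" for i using that by force
  define \<delta> where "\<delta> i = - (\<Sum>j\<in>S. A i j * y j) / y i" for i
  have "0 < minor (\<lambda>i j. (if i = j then \<delta> i else 0) + A i j) S"
    using S(1) A by (rule minor_add_diag_pos) (use neg y in \<open>auto simp: \<delta>_def divide_neg_pos\<close>)
  moreover obtain i0 where "i0 \<in> S" using S by blast
  then have "minor (\<lambda>i j. (if i = j then \<delta> i else 0) + A i j) S = 0"
  proof (rule minor_eq_0[OF S(1)])
    show "y i0 \<noteq> 0" using y \<open>i0 \<in> S\<close> by force
    fix i assume i: "i \<in> S"
    have "(\<Sum>j\<in>S. ((if i = j then \<delta> i else 0) + A i j) * y j)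
      = (\<Sum>j\<in>S. (if i = j then \<delta> i * y i else 0)) + (\<Sum>j\<in>S. A i j * y j)"
      by (simp add: distrib_right sum.distrib if_distrib[of "\<lambda>t. t * _"] cong: if_cong)
    also have "\<dots> = 0" using S(1) i y[OF i] by (simp add: \<delta>_def)
    finally show "(\<Sum>j\<in>S. ((if i = j then \<delta> i else 0) + A i j) * y j) = 0" .
  qed
  ultimately show False by simp
qed

text \<open>Cramer's rule: the solution is the adjugate applied to the right-hand side, divided by
  the determinant.\<close>

lemma minor_nonzero_solution:
  assumes "minor A {0..<n} \<noteq> 0"
  shows "\<exists>d. \<forall>i<n. (\<Sum>j<n. A i j * d j) = r i"
proof -
  let ?M = "mat n n (\<lambda>(i, j). A i j)"
  have M: "?M \<in> carrier_mat n n" by simp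
  have det: "det ?M \<noteq> 0"
    using assms minor_eq_det[of id n "{0..<n}" A] by simp
  let ?v = "(1 / det ?M) \<cdot>\<^sub>v (adj_mat ?M *\<^sub>v vec n r)"
  have adj: "adj_mat ?M \<in> carrier_mat n n" by (rule adj_mat(1)[OF M])
  have "?M *\<^sub>v ?v = (1 / det ?M) \<cdot>\<^sub>v (?M *\<^sub>v (adj_mat ?M *\<^sub>v vec n r))"
    using M adj by (intro mult_mat_vec) auto
  also have "?M *\<^sub>v (adj_mat ?M *\<^sub>v vec n r) = (?M * adj_mat ?M) *\<^sub>v vec n r"
    using M adj by (intro assoc_mult_mat_vec[symmetric]) auto
  also have "\<dots> = det ?M \<cdot>\<^sub>v vec n r"
    unfolding adj_mat(2)[OF M]
  proof (rule eq_vecI)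
    fix i assume i: "i < dim_vec (det ?M \<cdot>\<^sub>v vec n r)"
    then show "((det ?M \<cdot>\<^sub>m 1\<^sub>m n) *\<^sub>v vec n r) $ i = (det ?M \<cdot>\<^sub>v vec n r) $ i"
      by (simp add: scalar_prod_def if_distrib[of "\<lambda>t. _ * t"] if_distrib[of "\<lambda>t. t * _"] cong: if_cong)
  qed simp
  finally have *: "?M *\<^sub>v ?v = vec n r"
    using det by (simp add: smult_smult_assoc)
  have "(\<Sum>j<n. A i j * ?v $ j) = r i" if "i < n" for i
  proof -
    have "(?M *\<^sub>v ?v) $ i = (\<Sum>j<n. A i j * ?v $ j)"
      using that adj by (auto simp: scalar_prod_def atLeast0LessThan intro!: sum.cong)
    with * that show ?thesis by simp
  qed
  then show ?thesis by blast
qed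

section \<open>Positive vectors for irreducible M-matrices\<close>

text \<open>Adding \<open>e\<close> to the diagonal makes the determinant positive, hence the system
  solvable. On the set \<open>S\<close> where \<open>d\<close> is negative, \<open>- d\<close> is
  positive, so absence of sign reversal gives a row of \<open>S\<close> in which the sum over
  \<open>S\<close>, the sum over its complement and \<open>e * d i\<close> are all non-positive,
  against the value 1.\<close>

lemma Z_nonneg_minors_solution:
  fixes A :: "nat \<Rightarrow> nat \<Rightarrow> real"
  assumes Z: "\<And>i j. i < n \<Longrightarrow> j < n \<Longrightarrow> i \<noteq> j \<Longrightarrow> A i j \<le> 0"
    and A: "\<And>T. T \<subseteq> {0..<n} \<Longrightarrow> 0 \<le> minor A T" and e: "0 < e"
  shows "\<exists>d. \<forall>i<n. 0 \<le> d i \<and> (\<Sum>j<n. A i j * d j) + e * d i = 1"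
proof -
  have "0 < minor (\<lambda>i j. (if i = j then e else 0) + A i j) {0..<n}"
    using A e by (intro minor_add_diag_pos) auto
  then obtain d where d: "\<And>i. i < n \<Longrightarrow> (\<Sum>j<n. ((if i = j then e else 0) + A i j) * d j) = 1"
    using minor_nonzero_solution[of "\<lambda>i j. (if i = j then e else 0) + A i j" n "\<lambda>_. 1"] by force
  have eq: "(\<Sum>j<n. A i j * d j) + e * d i = 1" if "i < n" for i
  proof -
    have "(\<Sum>j<n. ((if i = j then e else 0) + A i j) * d j)
      = (\<Sum>j<n. (if i = j then e * d i else 0)) + (\<Sum>j<n. A i j * d j)"
      unfolding sum.distrib[symmetric] by (intro sum.cong) (auto simp: algebra_simps)
    with d[OF that] that show ?thesis by simp
  qed
  define S where "S = {i. i < n \<and> d i < 0}"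
  have "S = {}"
  proof (rule ccontr)
    assume "S \<noteq> {}"
    have "\<exists>i\<in>S. 0 \<le> (\<Sum>j\<in>S. A i j * - d j)"
      using \<open>S \<noteq> {}\<close> by (intro nonneg_minors_no_sign_reversal) (auto simp: S_def intro!: A)
    then obtain i where i: "i \<in> S" "0 \<le> (\<Sum>j\<in>S. A i j * - d j)" by blast
    have "(\<Sum>j<n. A i j * d j) = (\<Sum>j\<in>S. A i j * d j) + (\<Sum>j\<in>{..<n} - S. A i j * d j)"
      by (subst sum.subset_diff[of S]) (auto simp: S_def)
    moreover have "(\<Sum>j\<in>{..<n} - S. A i j * d j) \<le> 0"
      using i(1) by (intro sum_nonpos mult_nonpos_nonneg Z) (auto simp: S_def)
    moreover have "e * d i < 0" using i(1) e by (auto simp: S_def mult_pos_neg)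
    ultimately show False
      using i eq[of i] by (auto simp: sum_negf S_def)
  qed
  then have "0 \<le> d i" if "i < n" for i using that by (force simp: S_def)
  with eq show ?thesis by blast
qed

text \<open>Bolzano-Weierstrass in \<open>n\<close> coordinates: each induction step thins the
  subsequence further so that one more coordinate becomes monotone.\<close>

lemma Bseq_common_convergent_subseq:
  fixes X :: "nat \<Rightarrow> nat \<Rightarrow> real"
  assumes "\<And>i. i < n \<Longrightarrow> Bseq (\<lambda>k. X k i)"
  shows "\<exists>r. strict_mono r \<and> (\<forall>i<n. convergent (\<lambda>k. X (r k) i))"
  using assms
proof (induction n)
  case 0
  show ?case by (auto intro!: exI[of _ id] simp: strict_mono_def)
next
  case (Suc n)
  then obtain r where r: "strict_mono r" "\<forall>i<n. convergent (\<lambda>k. X (r k) i)"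
    by auto
  obtain q where q: "strict_mono q" "monoseq (\<lambda>k. X (r (q k)) n)"
    using seq_monosub[of "\<lambda>k. X (r k) n"] by blast
  have "Bseq (\<lambda>k. X (r (q k)) n)"
    using Bseq_subseq[OF Suc.prems[of n], of "r \<circ> q"] by (simp add: o_def)
  then have "convergent (\<lambda>k. X (r (q k)) n)"
    using q(2) by (rule Bseq_monoseq_convergent)
  moreover have "convergent (\<lambda>k. X (r (q k)) i)" if "i < n" for i
    using convergent_subseq_convergent[of "\<lambda>k. X (r k) i" q] r(2) that q(1) by (simp add: o_def)
  ultimately show ?case
    using r(1) q(1) by (intro exI[of _ "r \<circ> q"]) (auto simp: strict_mono_compose o_def less_Suc_eq)
qed

text \<open>The solutions for diagonal shifts \<open>e k\<close> tending to 0 may be unbounded, so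
  they are divided by their coordinate sums. A limit point exists by compactness, and its coordinate
  sum 1 keeps it from being zero.\<close>

lemma Z_nonneg_minors_nonneg_vector:
  fixes A :: "nat \<Rightarrow> nat \<Rightarrow> real"
  assumes n: "0 < n"
    and Z: "\<And>i j. i < n \<Longrightarrow> j < n \<Longrightarrow> i \<noteq> j \<Longrightarrow> A i j \<le> 0"
    and A: "\<And>T. T \<subseteq> {0..<n} \<Longrightarrow> 0 \<le> minor A T"
  shows "\<exists>d. (\<forall>i<n. 0 \<le> d i \<and> 0 \<le> (\<Sum>j<n. A i j * d j)) \<and> (\<Sum>i<n. d i) = 1"
proof -
  define e where "e k = 1 / real (Suc k)" for k
  have "\<exists>d. \<forall>i<n. 0 \<le> d i \<and> (\<Sum>j<n. A i j * d j) + e k * d i = 1" for k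
    by (intro Z_nonneg_minors_solution Z A) (auto simp: e_def)
  then obtain d where d0: "\<And>k i. i < n \<Longrightarrow> 0 \<le> d k i"
    and d1: "\<And>k i. i < n \<Longrightarrow> (\<Sum>j<n. A i j * d k j) + e k * d k i = 1" by metis
  define s where "s k = (\<Sum>i<n. d k i)" for k
  \<comment> \<open>A vanishing sum would force \<open>d k\<close> to be zero, and row 0 of its
    equation would read 0 = 1.\<close>
  have s: "0 < s k" for k
  proof (rule ccontr)
    assume "\<not> 0 < s k"
    moreover have "0 \<le> s k" unfolding s_def using d0 by (intro sum_nonneg) auto
    ultimately have "(\<Sum>i<n. d k i) = 0" by (simp add: s_def)
    then have "\<forall>i\<in>{..<n}. d k i = 0" using d0 by (subst (asm) sum_nonneg_eq_0_iff) auto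
    then show False using d1[of 0 k] n by simp
  qed
  define X where "X k i = d k i / s k" for k i
  have X0: "0 \<le> X k i" if "i < n" for k i using d0 s that by (simp add: X_def less_imp_le)
  have X1: "(\<Sum>i<n. X k i) = 1" for k
    using s[of k] by (simp add: X_def sum_divide_distrib[symmetric]) (simp add: s_def)
  have X_le: "X k i \<le> 1" if "i < n" for k i
    unfolding X1[of k, symmetric] using that X0 by (intro member_le_sum) auto
  have AX: "0 \<le> (\<Sum>j<n. A i j * X k j) + e k * X k i" if "i < n" for k i
  proof -
    have "(\<Sum>j<n. A i j * X k j) + e k * X k i = ((\<Sum>j<n. A i j * d k j) + e k * d k i) / s k"
      by (simp add: X_def add_divide_distrib sum_divide_distrib)
    then show ?thesis using d1[OF that] s[of k] by simp
  qed
  obtain r where r: "strict_mono r" "\<forall>i<n. convergent (\<lambda>k. X (r k) i)"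
    using Bseq_common_convergent_subseq[of n X] X0 X_le
    by (metis BseqI' real_norm_def abs_of_nonneg)
  define x where "x i = lim (\<lambda>k. X (r k) i)" for i
  have x: "(\<lambda>k. X (r k) i) \<longlonglongrightarrow> x i" if "i < n" for i
    using r(2) that by (simp add: x_def convergent_LIMSEQ_iff)
  have "e \<longlonglongrightarrow> 0" unfolding e_def by (rule LIMSEQ_Suc[OF lim_1_over_n])
  then have er: "(\<lambda>k. e (r k)) \<longlonglongrightarrow> 0"
    using LIMSEQ_subseq_LIMSEQ[OF _ r(1)] by (fastforce simp: o_def)
  have "(\<lambda>k. (\<Sum>j<n. A i j * X (r k) j) + e (r k) * X (r k) i) \<longlonglongrightarrow> (\<Sum>j<n. A i j * x j) + 0 * x i"
    if "i < n" for i
    using that by (intro tendsto_intros x er) auto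
  then have "0 \<le> (\<Sum>j<n. A i j * x j)" if "i < n" for i
    using LIMSEQ_le_const[of _ "(\<Sum>j<n. A i j * x j) + 0 * x i" 0] AX that by fastforce
  moreover have "0 \<le> x i" if "i < n" for i
    using LIMSEQ_le_const[OF x[OF that], of 0] X0[OF that] by blast
  moreover have "(\<lambda>k. \<Sum>i<n. X (r k) i) \<longlonglongrightarrow> (\<Sum>i<n. x i)"
    by (intro tendsto_intros x) auto
  then have "(\<Sum>i<n. x i) = 1"
    using X1 by (simp add: LIMSEQ_const_iff)
  ultimately show ?thesis by blast
qed

text \<open>Let \<open>S\<close> be the zero set of the non-negative vector \<open>d\<close>. If
  \<open>S\<close> is non-empty, it is proper since \<open>d\<close> has sum 1, and
  \<open>irred\<close> links a row of \<open>S\<close> to a column outside by a negative entry. In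
  that row all products are non-positive and one is negative, contrary to the choice of
  \<open>d\<close>.\<close>

lemma Z_irreducible_pos_vector:
  fixes A :: "nat \<Rightarrow> nat \<Rightarrow> real"
  assumes n: "0 < n"
    and Z: "\<And>i j. i < n \<Longrightarrow> j < n \<Longrightarrow> i \<noteq> j \<Longrightarrow> A i j \<le> 0"
    and A: "\<And>T. T \<subseteq> {0..<n} \<Longrightarrow> 0 \<le> minor A T"
    and irred: "\<And>S. S \<subset> {0..<n} \<Longrightarrow> S \<noteq> {} \<Longrightarrow> \<exists>i\<in>S. \<exists>j\<in>{0..<n} - S. A i j \<noteq> 0"
  shows "\<exists>d. \<forall>i<n. 0 < d i \<and> 0 \<le> (\<Sum>j<n. A i j * d j)"
proof -
  have "\<exists>d. (\<forall>i<n. 0 \<le> d i \<and> 0 \<le> (\<Sum>j<n. A i j * d j)) \<and> (\<Sum>i<n. d i) = 1"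
    by (rule Z_nonneg_minors_nonneg_vector[OF n Z A])
  then obtain d where dA: "\<forall>i<n. 0 \<le> d i \<and> 0 \<le> (\<Sum>j<n. A i j * d j)"
    and d1: "(\<Sum>i<n. d i) = 1" by (elim exE conjE)
  then have d: "0 \<le> d i" "0 \<le> (\<Sum>j<n. A i j * d j)" if "i < n" for i using that by simp_all
  define S where "S = {i. i < n \<and> d i = 0}"
  have "S = {}"
  proof (rule ccontr)
    assume "S \<noteq> {}"
    have "S \<noteq> {0..<n}"
    proof
      assume S: "S = {0..<n}"
      have "d i = 0" if "i < n" for i
      proof -
        have "i \<in> S" using S that by simp
        then show ?thesis by (simp add: S_def)
      qed
      with d1 show False by simp
    qed
    moreover have "S \<subseteq> {0..<n}" by (auto simp: S_def)
    ultimately have "S \<subset> {0..<n}" by (rule psubsetI[rotated])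
    then obtain i k where "i \<in> S" "k \<in> {0..<n} - S" "A i k \<noteq> 0"
      using irred[OF _ \<open>S \<noteq> {}\<close>] by blast
    then have i: "i < n" "d i = 0" and k: "k < n" "d k \<noteq> 0" "A i k \<noteq> 0" and "i \<noteq> k"
      by (auto simp: S_def)
    have "A i k < 0" using Z[OF i(1) k(1) \<open>i \<noteq> k\<close>] k(3) by simp
    moreover have "0 < d k" using d(1)[OF k(1)] k(2) by simp
    ultimately have "A i k * d k < 0" by (rule mult_neg_pos)
    moreover have "A i j * d j \<le> 0" if "j < n" for j
      using Z[OF i(1) that] d(1)[OF that] i by (cases "i = j") (simp_all add: mult_nonpos_nonneg)
    ultimately have "(\<Sum>j<n. A i j * d j) < (\<Sum>j<n. 0)"
      using k(1) by (intro sum_strict_mono_ex1) auto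
    then show False using d(2)[OF i(1)] by simp
  qed
  then have "d i \<noteq> 0" if "i < n" for i using that by (auto simp: S_def)
  with d show ?thesis by (intro exI[of _ d]) (simp add: less_le)
qed

text \<open>Listing \<open>S\<close> first and its complement afterwards moves the zero entries into
  the upper right block; both blocks are non-empty because \<open>S\<close> is a non-empty proper
  subset.\<close>

lemma reducible_matrix_if_zero_block:
  assumes A: "A \<in> carrier_mat n n" and S: "S \<subset> {0..<n}" "S \<noteq> {}"
    and zero: "\<And>i j. i \<in> S \<Longrightarrow> j \<in> {0..<n} - S \<Longrightarrow> A $$ (i, j) = 0"
  shows "reducible_matrix A"
proof -
  have fin: "finite S" using S(1) finite_subset by blast
  let ?k = "card S" let ?l = "card ({0..<n} - S)"
  have k: "0 < ?k" using fin S(2) by (simp add: card_gt_0_iff)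
  have l: "0 < ?l" using S(1) by (auto simp: card_gt_0_iff)
  have kl: "?k + ?l = n"
    using S(1) fin card_mono[of "{0..<n}" S] by (auto simp: card_Diff_subset)
  have "card {?k..<n} = ?l" using kl by simp
  then obtain p where p: "bij_betw p {?k..<n} ({0..<n} - S)"
    using finite_same_card_bij[of "{?k..<n}" "{0..<n} - S"] by auto
  obtain q where q: "bij_betw q {0..<?k} S" using ex_bij_betw_nat_finite[OF fin] by blast
  \<comment> \<open>The identity beyond \<open>n\<close> is required by
    \<open>permutes\<close>.\<close>
  define \<pi> where "\<pi> i = (if i < ?k then q i else if i < n then p i else i)" for i
  have \<pi>S: "\<pi> i \<in> S" if "i < ?k" for i
    using q that by (auto simp: \<pi>_def bij_betw_def)
  have \<pi>C: "\<pi> i \<in> {0..<n} - S" if "?k \<le> i" "i < n" for i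
    using bij_betwE[OF p] that by (auto simp: \<pi>_def)
  have "bij_betw \<pi> {0..<?k} S"
    using q by (rule bij_betw_cong[THEN iffD1, rotated]) (auto simp: \<pi>_def)
  moreover have "bij_betw \<pi> {?k..<n} ({0..<n} - S)"
    using p by (rule bij_betw_cong[THEN iffD1, rotated]) (auto simp: \<pi>_def)
  ultimately have "bij_betw \<pi> ({0..<?k} \<union> {?k..<n}) (S \<union> ({0..<n} - S))"
    by (rule bij_betw_combine) auto
  moreover have "{0..<?k} \<union> {?k..<n} = {0..<n}" using kl by auto
  moreover have "S \<union> ({0..<n} - S) = {0..<n}" using S(1) by auto
  ultimately have "bij_betw \<pi> {0..<n} {0..<n}" by simp
  then have perm: "\<pi> permutes {0..<n}"
    by (rule bij_imp_permutes) (use kl in \<open>auto simp: \<pi>_def\<close>)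
  have \<pi>n: "\<pi> i < n" if "i < n" for i
    using permutes_in_image[OF perm, of i] that by simp
  define Q :: "real mat" where "Q = mat n n (\<lambda>(i, j). if j = \<pi> i then 1 else 0)"
  let ?B = "mat ?k ?k (\<lambda>(i, j). A $$ (\<pi> i, \<pi> j))"
  let ?C = "mat ?l ?k (\<lambda>(i, j). A $$ (\<pi> (?k + i), \<pi> j))"
  let ?D = "mat ?l ?l (\<lambda>(i, j). A $$ (\<pi> (?k + i), \<pi> (?k + j)))"
  have QX: "(Q * X) $$ (i, j) = X $$ (\<pi> i, j)"
    if "X \<in> carrier_mat n n" "i < n" "j < n" for X i j
    using that \<pi>n by (simp add: Q_def scalar_prod_def if_distrib[of "\<lambda>t. t * _"] cong: if_cong)
  have XQ: "(X * transpose_mat Q) $$ (i, j) = X $$ (i, \<pi> j)"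
    if "X \<in> carrier_mat n n" "i < n" "j < n" for X i j
    using that \<pi>n by (simp add: Q_def scalar_prod_def if_distrib[of "\<lambda>t. _ * t"] cong: if_cong)
  have "Q * A \<in> carrier_mat n n" 
    by (rule mult_carrier_mat[OF _ A]) (simp add: Q_def)
  then have QAQ: "(Q * A * transpose_mat Q) $$ (i, j) = A $$ (\<pi> i, \<pi> j)" if "i < n" "j < n" for i j
    using XQ QX A \<pi>n that by simp
  have "Q * A * transpose_mat Q = four_block_mat ?B (0\<^sub>m ?k ?l) ?C ?D"
  proof (rule eq_matI)
    fix i j assume "i < dim_row (four_block_mat ?B (0\<^sub>m ?k ?l) ?C ?D)"
      "j < dim_col (four_block_mat ?B (0\<^sub>m ?k ?l) ?C ?D)"
    then have ij: "i < n" "j < n" using kl by auto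
    show "(Q * A * transpose_mat Q) $$ (i, j) = four_block_mat ?B (0\<^sub>m ?k ?l) ?C ?D $$ (i, j)"
      unfolding QAQ[OF ij] using ij kl zero[OF \<pi>S \<pi>C, of i j] by auto
  qed (use A kl in \<open>auto simp: Q_def\<close>)
  moreover have "permutation_matrix n Q" using perm by (auto simp: permutation_matrix_def Q_def)
  moreover have "?B \<in> carrier_mat ?k ?k" "?C \<in> carrier_mat ?l ?k" "?D \<in> carrier_mat ?l ?l"
    by (rule mat_carrier)+
  ultimately show ?thesis
    unfolding reducible_matrix_def using A k l by blast
qed

section \<open>Upper limits of bounded sequences\<close>

text \<open>The epsilon form of the statement that the upper limit of the absolute values is at most
  \<open>C\<close>. It stays within the reals and passes easily through sums, products and
  delays.\<close>

definition limsup_le :: "(nat \<Rightarrow> real) \<Rightarrow> real \<Rightarrow> bool" where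
  "limsup_le u C \<longleftrightarrow> (\<forall>e>0. \<forall>\<^sub>F m in sequentially. \<bar>u m\<bar> \<le> C + e)"

lemma limsup_leI: "(\<And>e. 0 < e \<Longrightarrow> \<forall>\<^sub>F m in sequentially. \<bar>u m\<bar> \<le> C + e) \<Longrightarrow> limsup_le u C"
  by (simp add: limsup_le_def)

lemma limsup_leD: "limsup_le u C \<Longrightarrow> 0 < e \<Longrightarrow> \<forall>\<^sub>F m in sequentially. \<bar>u m\<bar> \<le> C + e"
  by (simp add: limsup_le_def)

lemma limsup_le_nonneg:
  assumes "limsup_le u C"
  shows "0 \<le> C"
proof (rule field_le_epsilon)
  fix e :: real assume "0 < e"
  then have "\<forall>\<^sub>F m in sequentially. \<bar>u m\<bar> \<le> C + e" by (rule limsup_leD[OF assms])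
  then obtain m where "\<bar>u m\<bar> \<le> C + e" by (auto simp: eventually_sequentially)
  then show "0 \<le> C + e" by linarith
qed

lemma limsup_le_bound: "(\<And>m. \<bar>u m\<bar> \<le> C) \<Longrightarrow> limsup_le u C"
  by (auto intro!: limsup_leI always_eventually intro: add_increasing2)

lemma limsup_le_dominated:
  assumes "limsup_le u C" "\<And>m. \<bar>v m\<bar> \<le> \<bar>u m\<bar>"
  shows "limsup_le v C"
proof (rule limsup_leI)
  fix e :: real assume "0 < e"
  then have "\<forall>\<^sub>F m in sequentially. \<bar>u m\<bar> \<le> C + e" by (rule limsup_leD[OF assms(1)])
  then show "\<forall>\<^sub>F m in sequentially. \<bar>v m\<bar> \<le> C + e"
    by eventually_elim (rule order_trans[OF assms(2)])
qed

lemma limsup_le_add: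
  assumes "limsup_le u C" "limsup_le v D"
  shows "limsup_le (\<lambda>m. u m + v m) (C + D)"
proof (rule limsup_leI)
  fix e :: real assume "0 < e"
  then have "\<forall>\<^sub>F m in sequentially. \<bar>u m\<bar> \<le> C + e / 2" "\<forall>\<^sub>F m in sequentially. \<bar>v m\<bar> \<le> D + e / 2"
    using assms by (auto intro!: limsup_leD)
  then show "\<forall>\<^sub>F m in sequentially. \<bar>u m + v m\<bar> \<le> C + D + e"
    by eventually_elim linarith
qed

lemma limsup_le_sum:
  assumes "\<And>j. j \<in> S \<Longrightarrow> limsup_le (u j) (C j)"
  shows "limsup_le (\<lambda>m. \<Sum>j\<in>S. u j m) (\<Sum>j\<in>S. C j)"
  using assms
proof (induction S rule: infinite_finite_induct)
  case (insert x S)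
  then show ?case by (simp add: limsup_le_add)
qed (auto intro: limsup_le_bound)

lemma limsup_le_mult:
  assumes u: "limsup_le u C" and v: "limsup_le v D"
  shows "limsup_le (\<lambda>m. u m * v m) (C * D)"
proof (rule limsup_leI)
  fix e :: real assume e: "0 < e"
  have C: "0 \<le> C" and D: "0 \<le> D" using u v by (auto dest: limsup_le_nonneg)
  \<comment> \<open>Since \<open>h\<close> is at most 1, \<open>(C + h) * (D + h)\<close> exceeds
    \<open>C * D\<close> by at most \<open>h * (C + D + 1)\<close>, which is at most
    \<open>e\<close>.\<close>
  define h where "h = min 1 (e / (C + D + 1))"
  have h: "0 < h" "h \<le> 1" using e C D by (auto simp: h_def)
  have "h \<le> e / (C + D + 1)" by (simp add: h_def)
  then have "h * (C + D + 1) \<le> e" using C D by (simp add: pos_le_divide_eq)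
  moreover have "h * h \<le> h * 1" using h by (intro mult_left_mono) auto
  ultimately have CD: "(C + h) * (D + h) \<le> C * D + e" by (simp add: algebra_simps)
  have "\<forall>\<^sub>F m in sequentially. \<bar>u m\<bar> \<le> C + h" "\<forall>\<^sub>F m in sequentially. \<bar>v m\<bar> \<le> D + h"
    using limsup_leD[OF u h(1)] limsup_leD[OF v h(1)] by auto
  then show "\<forall>\<^sub>F m in sequentially. \<bar>u m * v m\<bar> \<le> C * D + e"
  proof eventually_elim
    case (elim m)
    then have "\<bar>u m\<bar> * \<bar>v m\<bar> \<le> (C + h) * (D + h)" using C h by (intro mult_mono) auto
    with CD show ?case by (simp add: abs_mult)
  qed
qed

lemma limsup_le_0: "limsup_le u 0 \<longleftrightarrow> u \<longlonglongrightarrow> 0"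
proof
  assume u: "limsup_le u 0"
  show "u \<longlonglongrightarrow> 0"
  proof (rule tendstoI)
    fix e :: real assume "0 < e"
    then have "\<forall>\<^sub>F m in sequentially. \<bar>u m\<bar> \<le> 0 + e / 2" by (intro limsup_leD[OF u]) simp
    then show "\<forall>\<^sub>F m in sequentially. dist (u m) 0 < e"
      by eventually_elim (use \<open>0 < e\<close> in \<open>simp add: dist_real_def\<close>)
  qed
next
  assume u: "u \<longlonglongrightarrow> 0"
  show "limsup_le u 0"
  proof (rule limsup_leI)
    fix e :: real assume "0 < e"
    then have "\<forall>\<^sub>F m in sequentially. dist (u m) 0 < e" by (rule tendstoD[OF u])
    then show "\<forall>\<^sub>F m in sequentially. \<bar>u m\<bar> \<le> 0 + e"
      by eventually_elim (simp add: dist_real_def)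
  qed
qed

lemma limsup_le_shift: "limsup_le (\<lambda>m. u (Suc m)) C \<Longrightarrow> limsup_le u C"
  unfolding limsup_le_def by (simp add: eventually_sequentially_Suc[of "\<lambda>m. \<bar>u m\<bar> \<le> _"])

lemma limsup_le_eventually_cong:
  assumes "limsup_le u C" "\<forall>\<^sub>F m in sequentially. v m = u m"
  shows "limsup_le v C"
proof (rule limsup_leI)
  fix e :: real assume "0 < e"
  then have "\<forall>\<^sub>F m in sequentially. \<bar>u m\<bar> \<le> C + e" by (rule limsup_leD[OF assms(1)])
  with assms(2) show "\<forall>\<^sub>F m in sequentially. \<bar>v m\<bar> \<le> C + e" by eventually_elim simp
qed

text \<open>Delayed times are integers, and the final limit is taken along the integers too, so
  eventual statements about naturals are carried over.\<close>

lemma eventually_nat_imp_int: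
  assumes "\<forall>\<^sub>F m in sequentially. Q (int m)"
  shows "\<forall>\<^sub>F k in at_top. Q (k :: int)"
proof -
  obtain N where N: "\<And>m. N \<le> m \<Longrightarrow> Q (int m)" using assms by (auto simp: eventually_sequentially)
  have "Q k" if "int N \<le> k" for k using N[of "nat k"] that by (simp add: le_nat_iff)
  then show ?thesis by (auto simp: eventually_at_top_linorder)
qed

lemma limsup_le_delay:
  fixes w :: "int \<Rightarrow> real"
  assumes "limsup_le (\<lambda>m. w (int m)) C" "filterlim d at_top sequentially"
  shows "limsup_le (\<lambda>m. w (d m)) C"
proof (rule limsup_leI)
  fix e :: real assume "0 < e"
  then have "\<forall>\<^sub>F k in at_top. \<bar>w k\<bar> \<le> C + e"
    by (intro eventually_nat_imp_int limsup_leD[OF assms(1)])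
  then show "\<forall>\<^sub>F m in sequentially. \<bar>w (d m)\<bar> \<le> C + e"
    using assms(2) by (rule eventually_compose_filterlim)
qed

lemma weighted_sum_le:
  fixes \<zeta> v :: "nat \<Rightarrow> real"
  assumes \<zeta>: "(\<lambda>l. \<bar>\<zeta> l\<bar>) sums 1" and v: "\<And>l. \<bar>v l\<bar> \<le> C"
  shows "summable (\<lambda>l. \<bar>\<zeta> l * v l\<bar>)" "\<bar>\<Sum>l. \<zeta> l * v l\<bar> \<le> C"
proof -
  have C: "(\<lambda>l. \<bar>\<zeta> l\<bar> * C) sums (1 * C)" by (rule sums_mult2[OF \<zeta>])
  have le: "\<bar>\<zeta> l * v l\<bar> \<le> \<bar>\<zeta> l\<bar> * C" for l
    using v by (simp add: abs_mult mult_left_mono)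
  show s: "summable (\<lambda>l. \<bar>\<zeta> l * v l\<bar>)"
    using le by (intro summable_comparison_test'[OF sums_summable[OF C], of 0]) simp
  have "\<bar>\<Sum>l. \<zeta> l * v l\<bar> \<le> (\<Sum>l. \<bar>\<zeta> l * v l\<bar>)" by (rule summable_rabs[OF s])
  also have "\<dots> \<le> (\<Sum>l. \<bar>\<zeta> l\<bar> * C)" by (rule suminf_le[OF le s sums_summable[OF C]])
  also have "\<dots> = C" using C by (simp add: sums_iff)
  finally show "\<bar>\<Sum>l. \<zeta> l * v l\<bar> \<le> C" .
qed

text \<open>The sum is split at a fixed \<open>N\<close>: beyond it the weights are so small that
  the global bound \<open>B\<close> suffices, while the finitely many lags below it lead to late
  times, where \<open>w\<close> is nearly bounded by \<open>C\<close>.\<close>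

lemma limsup_le_convolution:
  fixes w :: "int \<Rightarrow> real" and \<zeta> :: "nat \<Rightarrow> real"
  assumes \<zeta>: "(\<lambda>l. \<bar>\<zeta> l\<bar>) sums 1" and B: "\<And>k. \<bar>w k\<bar> \<le> B"
    and w: "limsup_le (\<lambda>m. w (int m)) C"
  shows "limsup_le (\<lambda>m. \<Sum>l. \<zeta> l * w (int m - int l)) C"
proof (rule limsup_leI)
  fix e :: real assume e: "0 < e"
  have C: "0 \<le> C" by (rule limsup_le_nonneg[OF w])
  have B0: "0 \<le> B" using B[of 0] by linarith
  have "\<forall>\<^sub>F k in at_top. \<bar>w k\<bar> \<le> C + e / 2"
    using e by (intro eventually_nat_imp_int limsup_leD[OF w]) simp
  then obtain K where K: "\<And>k. K \<le> k \<Longrightarrow> \<bar>w k\<bar> \<le> C + e / 2"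
    by (auto simp: eventually_at_top_linorder)
  \<comment> \<open>Using \<open>B + 1\<close> in place of \<open>B\<close> keeps the denominator
    positive.\<close>
  obtain N where tail: "\<bar>\<Sum>l. \<bar>\<zeta> (l + N)\<bar>\<bar> < e / (2 * (B + 1))"
    using suminf_exist_split[OF _ sums_summable[OF \<zeta>], of "e / (2 * (B + 1))"] e B0 by auto
  have "(\<Sum>l. \<bar>\<zeta> (l + N)\<bar>) * B \<le> \<bar>\<Sum>l. \<bar>\<zeta> (l + N)\<bar>\<bar> * (B + 1)"
    using B0 by (intro mult_mono) auto
  also have "\<dots> < e / (2 * (B + 1)) * (B + 1)"
    using tail B0 by (intro mult_strict_right_mono) auto
  also have "\<dots> = e / 2" using B0 by (simp add: field_simps)
  finally have N: "(\<Sum>l. \<bar>\<zeta> (l + N)\<bar>) * B < e / 2" .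
  \<comment> \<open>The threshold ensures \<open>K \<le> int m - int l\<close> for every lag
    \<open>l < N\<close>.\<close>
  have "\<bar>\<Sum>l. \<zeta> l * w (int m - int l)\<bar> \<le> C + e" if m: "nat K + N \<le> m" for m
  proof -
    let ?t = "\<lambda>l. \<bar>\<zeta> l * w (int m - int l)\<bar>"
    have s: "summable ?t" by (rule weighted_sum_le(1)[OF \<zeta>]) (rule B)
    have sN: "summable (\<lambda>l. \<bar>\<zeta> (l + N)\<bar>)"
      using sums_summable[OF \<zeta>] by (simp add: summable_iff_shift[of "\<lambda>l. \<bar>\<zeta> l\<bar>"])
    have "\<bar>\<Sum>l. \<zeta> l * w (int m - int l)\<bar> \<le> (\<Sum>l. ?t l)" by (rule summable_rabs[OF s])
    also have "\<dots> = (\<Sum>l. ?t (l + N)) + (\<Sum>l<N. ?t l)" by (rule suminf_split_initial_segment[OF s])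
    also have "(\<Sum>l. ?t (l + N)) \<le> (\<Sum>l. \<bar>\<zeta> (l + N)\<bar> * B)"
    proof (rule suminf_le)
      show "?t (l + N) \<le> \<bar>\<zeta> (l + N)\<bar> * B" for l
        unfolding abs_mult by (intro mult_left_mono B) simp
      show "summable (\<lambda>l. ?t (l + N))" by (rule summable_ignore_initial_segment[OF s])
      show "summable (\<lambda>l. \<bar>\<zeta> (l + N)\<bar> * B)" by (rule summable_mult2[OF sN])
    qed
    also have "\<dots> = (\<Sum>l. \<bar>\<zeta> (l + N)\<bar>) * B" by (rule suminf_mult2[OF sN, symmetric])
    also have "(\<Sum>l<N. ?t l) \<le> (\<Sum>l<N. \<bar>\<zeta> l\<bar> * (C + e / 2))"
      unfolding abs_mult using m by (intro sum_mono mult_left_mono K) auto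
    also have "\<dots> = (\<Sum>l<N. \<bar>\<zeta> l\<bar>) * (C + e / 2)" by (rule sum_distrib_right[symmetric])
    also have "\<dots> \<le> 1 * (C + e / 2)"
      using sum_le_suminf[OF sums_summable[OF \<zeta>], of "{..<N}"] \<zeta> C e
      by (intro mult_right_mono) (auto simp: sums_iff)
    finally show ?thesis using N by simp
  qed
  then show "\<forall>\<^sub>F m in sequentially. \<bar>\<Sum>l. \<zeta> l * w (int m - int l)\<bar> \<le> C + e"
    by (auto simp: eventually_sequentially)
qed

text \<open>A bound for all times is also an asymptotic bound, so \<open>abs_sup\<close> can stand
  in the second part where \<open>abs_limsup\<close> stands in the first.\<close>

lemma limsup_le_abs_sup:
  assumes "Bseq u"
  shows "\<bar>u m\<bar> \<le> abs_sup u" "limsup_le u (abs_sup u)"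
proof -
  have "bdd_above (range (\<lambda>m. \<bar>u m\<bar>))"
    using assms by (auto simp: Bseq_def bdd_above_def)
  then have *: "\<bar>u m\<bar> \<le> abs_sup u" for m
    unfolding abs_sup_def by (rule cSUP_upper[rotated]) simp
  then show "\<bar>u m\<bar> \<le> abs_sup u" "limsup_le u (abs_sup u)" by (auto intro: limsup_le_bound)
qed

text \<open>The epsilon characterisation holds for the upper limit in the extended reals;
  boundedness makes that limit finite, so the conversion to a real number loses nothing.\<close>

lemma limsup_le_iff_abs_limsup:
  assumes "Bseq u"
  shows "limsup_le u C \<longleftrightarrow> abs_limsup u \<le> C"
proof -
  let ?L = "limsup (\<lambda>m. ereal \<bar>u m\<bar>)"
  have ereal_le: "limsup_le u D \<longleftrightarrow> ?L \<le> ereal D" for D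
  proof
    assume D: "limsup_le u D"
    show "?L \<le> ereal D"
    proof (rule ereal_le_epsilon2)
      fix e :: real assume "0 < e"
      then have "\<forall>\<^sub>F m in sequentially. ereal \<bar>u m\<bar> \<le> ereal (D + e)"
        using limsup_leD[OF D] by simp
      then have "?L \<le> ereal (D + e)" by (rule Limsup_bounded)
      then show "?L \<le> ereal D + ereal e" by simp
    qed
  next
    assume D: "?L \<le> ereal D"
    show "limsup_le u D"
    proof (rule limsup_leI)
      fix e :: real assume "0 < e"
      then have "ereal D < ereal (D + e)" by simp
      with D have "?L < ereal (D + e)" by (rule le_less_trans)
      then have "\<forall>\<^sub>F m in sequentially. ereal \<bar>u m\<bar> < ereal (D + e)" by (rule Limsup_lessD)
      then show "\<forall>\<^sub>F m in sequentially. \<bar>u m\<bar> \<le> D + e" by eventually_elim simp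
    qed
  qed
  obtain B where "\<And>m. \<bar>u m\<bar> \<le> B" using assms by (auto simp: Bseq_def)
  then have "?L \<le> ereal B" unfolding ereal_le[symmetric] by (rule limsup_le_bound)
  moreover have "0 \<le> ?L" by (rule le_Limsup) auto
  ultimately have "ereal (abs_limsup u) = ?L"
    unfolding abs_limsup_def by (intro ereal_real') auto
  then show ?thesis unfolding ereal_le by (simp only: ereal_less_eq(3) flip: \<open>ereal (abs_limsup u) = ?L\<close>)
qed

lemma limsup_le_abs_limsup: "Bseq u \<Longrightarrow> limsup_le u (abs_limsup u)"
  by (simp add: limsup_le_iff_abs_limsup)

section \<open>Sublinear functions\<close>

text \<open>The strict inequality is silent at 0; continuity along the sequence
  \<open>1 / (k + 1)\<close> settles the value there.\<close>

lemma sublinear_zero: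
  assumes "sublinear h K"
  shows "h 0 = 0"
proof -
  define s where "s k = 1 / real (Suc k)" for k
  have s: "s \<longlonglongrightarrow> 0" unfolding s_def by (rule LIMSEQ_Suc[OF lim_1_over_n])
  have "isCont h 0"
    using assms by (simp add: sublinear_def continuous_on_eq_continuous_at)
  then have "(\<lambda>k. h (s k)) \<longlonglongrightarrow> h 0" by (rule isCont_tendsto_compose[OF _ s])
  moreover have "(\<lambda>k. h (s k)) \<longlonglongrightarrow> 0"
  proof (rule tendsto_0_le[OF s])
    have "s k \<noteq> 0" for k by (simp add: s_def)
    then have "\<bar>h (s k)\<bar> < K * \<bar>s k\<bar>" for k
      using assms unfolding sublinear_def by blast
    then show "\<forall>\<^sub>F k in sequentially. norm (h (s k)) \<le> norm (s k) * K"
      by (intro always_eventually) (simp add: mult.commute less_imp_le)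
  qed
  ultimately show ?thesis by (rule LIMSEQ_unique)
qed

lemma sublinear_le:
  assumes "sublinear h K"
  shows "\<bar>h u\<bar> \<le> K * \<bar>u\<bar>"
  using assms sublinear_zero[OF assms] by (cases "u = 0") (auto simp: sublinear_def less_imp_le)

text \<open>Outside \<open>[-1, 1]\<close> the cap \<open>K\<close> lies strictly below
  \<open>K * \<bar>u\<bar>\<close>. Hence one convergence argument serves both parts.\<close>

lemma sublinear_capped_imp_sublinear:
  assumes h: "sublinear_capped h K" and K: "0 < K"
  shows "sublinear h K"
  unfolding sublinear_def
proof (intro conjI allI impI)
  show "continuous_on UNIV h" using h by (simp add: sublinear_capped_def)
  fix u :: real assume u: "u \<noteq> 0"
  show "\<bar>h u\<bar> < K * \<bar>u\<bar>"
  proof (cases "\<bar>u\<bar> \<le> 1")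
    case True
    then show ?thesis using h u by (simp add: sublinear_capped_def)
  next
    case False
    then have "\<bar>h u\<bar> \<le> K" using h by (simp add: sublinear_capped_def)
    also have "K < K * \<bar>u\<bar>" using False K by simp
    finally show ?thesis .
  qed
qed

lemma sublinear_capped_le:
  assumes h: "sublinear_capped h K" and K: "0 < K"
  shows "\<bar>h u\<bar> \<le> K"
proof (cases "\<bar>u\<bar> \<le> 1")
  case True
  have "\<bar>h u\<bar> \<le> K * \<bar>u\<bar>" by (rule sublinear_le[OF sublinear_capped_imp_sublinear[OF h K]])
  also have "\<dots> \<le> K * 1" using True K by (intro mult_left_mono) auto
  finally show ?thesis by simp
next
  case False
  then show ?thesis using h by (simp add: sublinear_capped_def)
qed

lemma Bseq_sublinear:
  assumes h: "sublinear h K" and "0 < K" "Bseq u"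
  shows "Bseq (\<lambda>m. h (u m))"
proof -
  obtain B where B: "\<And>m. \<bar>u m\<bar> \<le> B" using assms(3) by (auto simp: Bseq_def)
  have "\<bar>h (u m)\<bar> \<le> K * B" for m
    using sublinear_le[OF h, of "u m"] mult_left_mono[OF B[of m], of K] \<open>0 < K\<close> by linarith
  then show ?thesis by (intro BseqI') auto
qed

lemma abs_limsup_sublinear_le:
  assumes h: "sublinear h K" and K: "0 < K" and u: "Bseq u"
  shows "abs_limsup (\<lambda>m. h (u m)) \<le> K * abs_limsup u"
proof -
  have "limsup_le (\<lambda>m. K * u m) (K * abs_limsup u)"
    using K by (intro limsup_le_mult limsup_le_bound limsup_le_abs_limsup u) auto
  then have "limsup_le (\<lambda>m. h (u m)) (K * abs_limsup u)"
  proof (rule limsup_le_dominated)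
    show "\<bar>h (u m)\<bar> \<le> \<bar>K * u m\<bar>" for m
      using sublinear_le[OF h, of "u m"] K by (simp add: abs_mult)
  qed
  then show ?thesis by (simp only: limsup_le_iff_abs_limsup[OF Bseq_sublinear[OF h K u]])
qed

text \<open>On the compact set where \<open>\<bar>v\<bar>\<close> lies between half and twice the upper limit, the ratio
  \<open>\<bar>h v\<bar> / \<bar>v\<bar>\<close> attains a maximum below \<open>K\<close>.\<close>

lemma abs_limsup_sublinear_less:
  assumes h: "sublinear h K" and K: "0 < K" and u: "Bseq u" and L: "0 < abs_limsup u"
  shows "abs_limsup (\<lambda>m. h (u m)) < K * abs_limsup u"
proof -
  define L where "L = abs_limsup u"
  have L0: "0 < L" using L by (simp add: L_def)
  let ?C = "{-(2 * L)..2 * L} \<inter> {v. L / 2 \<le> \<bar>v\<bar>}"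
  have "continuous_on ?C h" using h continuous_on_subset by (auto simp: sublinear_def)
  then have "continuous_on ?C (\<lambda>v. \<bar>h v\<bar> / \<bar>v\<bar>)"
    using L0 by (intro continuous_intros) auto
  moreover have "compact ?C" by (intro compact_Int_closed compact_Icc closed_Collect_le continuous_intros)
  moreover have "L \<in> ?C" using L0 by simp
  then have "?C \<noteq> {}" by blast
  ultimately obtain w where w: "w \<in> ?C" and w_max: "\<And>v. v \<in> ?C \<Longrightarrow> \<bar>h v\<bar> / \<bar>v\<bar> \<le> \<bar>h w\<bar> / \<bar>w\<bar>"
    using continuous_attains_sup[of ?C "\<lambda>v. \<bar>h v\<bar> / \<bar>v\<bar>"] by blast
  define r where "r = \<bar>h w\<bar> / \<bar>w\<bar>"
  have w0: "w \<noteq> 0" using w L0 by auto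
  then have rK: "r < K" using h by (simp add: r_def sublinear_def pos_divide_less_eq)
  have r0: "0 \<le> r" by (simp add: r_def)
  \<comment> \<open>With this value \<open>K * e\<close> is half of the gap
    \<open>(K - r) * L\<close>, so \<open>r * (L + e)\<close> stays below \<open>K * L\<close>;
    moreover \<open>e\<close> is at most \<open>L / 2\<close>, so values up to \<open>L + e\<close>
    remain in the compact range.\<close>
  define e where "e = L * (K - r) / (2 * K)"
  have e0: "0 < e" using L0 rK K by (simp add: e_def)
  have "(K - r) / (2 * K) \<le> 1 / 2" using r0 K by (simp add: divide_le_eq)
  then have "L * ((K - r) / (2 * K)) \<le> L * (1 / 2)" using L0 by (intro mult_left_mono) auto
  then have eL: "e \<le> L / 2" by (simp add: e_def)
  have "r * (L + e) \<le> r * L + K * e" using rK e0 by (simp add: distrib_left mult_right_mono)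
  also have "K * e = (K - r) * L / 2" using K by (simp add: e_def field_simps)
  also have "r * L + (K - r) * L / 2 < K * L" using rK L0 by (simp add: field_simps)
  finally have rL: "r * (L + e) < K * L" .
  \<comment> \<open>The two entries bound \<open>\<bar>h v\<bar>\<close> for large and for small
    \<open>\<bar>v\<bar>\<close>, with \<open>L / 2\<close> as the dividing line.\<close>
  define D where "D = max (r * (L + e)) (K * (L / 2))"
  have DL: "D < K * L" using rL K L0 by (simp add: D_def)
  have hv: "\<bar>h v\<bar> \<le> D" if v: "\<bar>v\<bar> \<le> L + e" for v
  proof (cases "L / 2 \<le> \<bar>v\<bar>")
    case True
    then have "v \<in> ?C" using v eL L0 by auto
    moreover have "0 < \<bar>v\<bar>" using True L0 by linarith
    ultimately have "\<bar>h v\<bar> \<le> r * \<bar>v\<bar>" using w_max[of v] by (simp add: r_def[symmetric] pos_divide_le_eq)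
    also have "\<dots> \<le> r * (L + e)" using v r0 by (intro mult_left_mono)
    finally show ?thesis by (simp add: D_def)
  next
    case False
    have "\<bar>h v\<bar> \<le> K * \<bar>v\<bar>" by (rule sublinear_le[OF h])
    also have "\<dots> \<le> K * (L / 2)" using False K by (intro mult_left_mono) auto
    finally show ?thesis by (simp add: D_def)
  qed
  have "limsup_le (\<lambda>m. h (u m)) D"
  proof (rule limsup_leI)
    fix e' :: real assume "0 < e'"
    have "\<forall>\<^sub>F m in sequentially. \<bar>u m\<bar> \<le> L + e"
      using limsup_leD[OF limsup_le_abs_limsup[OF u] e0] by (simp add: L_def)
    then show "\<forall>\<^sub>F m in sequentially. \<bar>h (u m)\<bar> \<le> D + e'"
      by eventually_elim (use hv \<open>0 < e'\<close> in force)
  qed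
  then have "abs_limsup (\<lambda>m. h (u m)) \<le> D"
    by (simp only: limsup_le_iff_abs_limsup[OF Bseq_sublinear[OF h K u]])
  with DL show ?thesis by (simp add: L_def)
qed

section \<open>Solutions of the delay system\<close>

text \<open>The common ground of both parts: the solution enters through its coordinate functions
  \<open>y i\<close>, the nonlinearities are sublinear, and the matrix conditions are supplied lemma
  by lemma.\<close>

locale delay_system =
  fixes n P :: nat
    and a :: "nat \<Rightarrow> nat \<Rightarrow> real"
    and \<nu> :: "nat \<Rightarrow> nat \<Rightarrow> nat"
    and b :: "nat \<Rightarrow> nat \<Rightarrow> nat \<Rightarrow> nat \<Rightarrow> real"
    and \<tau> :: "nat \<Rightarrow> nat \<Rightarrow> nat \<Rightarrow> nat \<Rightarrow> nat"
    and f :: "nat \<Rightarrow> nat \<Rightarrow> nat \<Rightarrow> real \<Rightarrow> real"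
    and c :: "nat \<Rightarrow> nat \<Rightarrow> nat \<Rightarrow> real"
    and \<zeta> :: "nat \<Rightarrow> nat \<Rightarrow> nat \<Rightarrow> real"
    and g :: "nat \<Rightarrow> nat \<Rightarrow> real \<Rightarrow> real"
    and I :: "nat \<Rightarrow> nat \<Rightarrow> real"
    and F :: "nat \<Rightarrow> nat \<Rightarrow> nat \<Rightarrow> real"
    and G :: "nat \<Rightarrow> nat \<Rightarrow> real"
    and \<sigma> :: nat
    and y :: "nat \<Rightarrow> int \<Rightarrow> real"
  assumes a_Bseq: "\<And>i. i < n \<Longrightarrow> Bseq (a i)"
    and a_less_1: "\<And>i. i < n \<Longrightarrow> abs_sup (a i) < 1"
    and \<nu>_lim: "\<And>i. i < n \<Longrightarrow> filterlim (\<lambda>m. int m - int (\<nu> i m)) at_top at_top"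
    and \<tau>_lim: "\<And>i j p. \<lbrakk>i < n; j < n; p < P\<rbrakk> \<Longrightarrow>
                  filterlim (\<lambda>m. int m - int (\<tau> i j p m)) at_top at_top"
    and b_Bseq: "\<And>i j p. \<lbrakk>i < n; j < n; p < P\<rbrakk> \<Longrightarrow> Bseq (b i j p)"
    and c_Bseq: "\<And>i j. \<lbrakk>i < n; j < n\<rbrakk> \<Longrightarrow> Bseq (c i j)"
    and \<zeta>_sums: "\<And>i j. \<lbrakk>i < n; j < n\<rbrakk> \<Longrightarrow> (\<lambda>l. \<bar>\<zeta> i j l\<bar>) sums 1"
    and I_summable: "\<And>i. i < n \<Longrightarrow> summable (\<lambda>m. \<bar>I i m\<bar>)"
    and F_pos: "\<And>i j p. \<lbrakk>i < n; j < n; p < P\<rbrakk> \<Longrightarrow> F i j p > 0"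
    and G_pos: "\<And>i j. \<lbrakk>i < n; j < n\<rbrakk> \<Longrightarrow> G i j > 0"
    and f_sublinear: "\<And>i j p. \<lbrakk>i < n; j < n; p < P\<rbrakk> \<Longrightarrow> sublinear (f i j p) (F i j p)"
    and g_sublinear: "\<And>i j. \<lbrakk>i < n; j < n\<rbrakk> \<Longrightarrow> sublinear (g i j) (G i j)"
    and initial_bounded: "\<exists>B. \<forall>i<n. \<forall>k\<le>int \<sigma>. \<bar>y i k\<bar> \<le> B"
    and step: "\<And>m i. \<sigma> \<le> m \<Longrightarrow> i < n \<Longrightarrow> y i (int m + 1) =
       a i m * y i (int m - int (\<nu> i m))
     + (\<Sum>j<n. \<Sum>p<P. b i j p m * f i j p (y j (int m - int (\<tau> i j p m))))
     + (\<Sum>j<n. c i j m * (\<Sum>l. \<zeta> i j l * g i j (y j (int m - int l))))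
     + I i m"
begin

text \<open>Triangle inequality with every coefficient replaced by its supremum. The bounds on the
  history are kept as parameters so that constant bounds and bounds proportional to a vector can
  both be inserted.\<close>

lemma abs_step_le:
  assumes m: "\<sigma> \<le> m" and i: "i < n"
    and X: "\<And>k. k \<le> int m \<Longrightarrow> \<bar>y i k\<bar> \<le> X"
    and \<Phi>: "\<And>j p k. \<lbrakk>j < n; p < P; k \<le> int m\<rbrakk> \<Longrightarrow> \<bar>f i j p (y j k)\<bar> \<le> \<Phi> j p"
    and \<Gamma>: "\<And>j k. \<lbrakk>j < n; k \<le> int m\<rbrakk> \<Longrightarrow> \<bar>g i j (y j k)\<bar> \<le> \<Gamma> j"
  shows "\<bar>y i (int m + 1)\<bar> \<le> abs_sup (a i) * X
    + (\<Sum>j<n. abs_sup (c i j) * \<Gamma> j + (\<Sum>p<P. abs_sup (b i j p) * \<Phi> j p)) + \<bar>I i m\<bar>"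
proof -
  have prod_le: "\<bar>u m * v\<bar> \<le> abs_sup u * V" if "Bseq u" "\<bar>v\<bar> \<le> V" for u v V
    unfolding abs_mult using limsup_le_abs_sup(1)[OF that(1), of m] that(2)
    by (intro mult_mono) (auto intro: order_trans[OF abs_ge_zero])
  have "\<bar>a i m * y i (int m - int (\<nu> i m))\<bar> \<le> abs_sup (a i) * X"
    using i by (intro prod_le a_Bseq X) auto
  moreover have "\<bar>\<Sum>j<n. \<Sum>p<P. b i j p m * f i j p (y j (int m - int (\<tau> i j p m)))\<bar>
      \<le> (\<Sum>j<n. \<Sum>p<P. abs_sup (b i j p) * \<Phi> j p)"
    using i by (intro order_trans[OF sum_abs] sum_mono prod_le b_Bseq \<Phi>) auto
  moreover have "\<bar>\<Sum>j<n. c i j m * (\<Sum>l. \<zeta> i j l * g i j (y j (int m - int l)))\<bar>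
      \<le> (\<Sum>j<n. abs_sup (c i j) * \<Gamma> j)"
    using i by (intro order_trans[OF sum_abs] sum_mono prod_le c_Bseq weighted_sum_le(2) \<zeta>_sums \<Gamma>) auto
  ultimately show ?thesis
    unfolding step[OF m i] sum.distrib by linarith
qed

text \<open>The delays may reach arbitrarily far back, so \<open>V i m\<close> has to bound the
  whole history up to time \<open>m\<close>; monotonicity of \<open>V\<close> carries the earlier
  bounds along.\<close>

lemma history_induct:
  assumes mono: "\<And>i m. i < n \<Longrightarrow> V i m \<le> V i (Suc m)"
    and base: "\<And>i k. i < n \<Longrightarrow> k \<le> int \<sigma> \<Longrightarrow> \<bar>y i k\<bar> \<le> V i \<sigma>"
    and ind: "\<And>i m. \<lbrakk>\<sigma> \<le> m; i < n; \<And>j k. j < n \<Longrightarrow> k \<le> int m \<Longrightarrow> \<bar>y j k\<bar> \<le> V j m\<rbrakk>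
      \<Longrightarrow> \<bar>y i (int m + 1)\<bar> \<le> V i (Suc m)"
    and bound: "\<And>i m. i < n \<Longrightarrow> V i m \<le> B"
  shows "\<forall>i<n. \<forall>k. \<bar>y i k\<bar> \<le> B"
proof -
  have *: "\<forall>i<n. \<forall>k\<le>int (\<sigma> + d). \<bar>y i k\<bar> \<le> V i (\<sigma> + d)" for d
  proof (induction d)
    case 0
    show ?case using base by simp
  next
    case (Suc d)
    show ?case
    proof (intro allI impI)
      fix i k assume i: "i < n" and k: "k \<le> int (\<sigma> + Suc d)"
      show "\<bar>y i k\<bar> \<le> V i (\<sigma> + Suc d)"
      proof (cases "k \<le> int (\<sigma> + d)")
        case True
        then have "\<bar>y i k\<bar> \<le> V i (\<sigma> + d)" using Suc i by blast
        also have "\<dots> \<le> V i (\<sigma> + Suc d)" using mono[OF i] by simp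
        finally show ?thesis .
      next
        case False
        then have "k = int (\<sigma> + d) + 1" using k by simp
        then show ?thesis using ind[of "\<sigma> + d" i] Suc i by simp
      qed
    qed
  qed
  have "\<bar>y i k\<bar> \<le> B" if "i < n" for i k
  proof -
    \<comment> \<open>This also holds for negative \<open>k\<close>, where \<open>nat k\<close> is
      0.\<close>
    have "k \<le> int (\<sigma> + nat k)" by simp
    then have "\<bar>y i k\<bar> \<le> V i (\<sigma> + nat k)" using *[of "nat k"] that by blast
    also have "\<dots> \<le> B" by (rule bound[OF that])
    finally show ?thesis .
  qed
  then show ?thesis by blast
qed

lemma abs_sup_nonneg: "Bseq u \<Longrightarrow> 0 \<le> abs_sup u"
  using limsup_le_abs_sup(1)[of u 0] by linarith

text \<open>Nonlinearities and inputs contribute at most a constant \<open>K i\<close> per step.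
  Since \<open>abs_sup (a i) < 1\<close>, a box of side \<open>B\<close> with
  \<open>K i \<le> (1 - abs_sup (a i)) * B\<close> is invariant.\<close>

lemma bounded_if_nonlinearities_bounded:
  assumes f: "\<And>i j p u. \<lbrakk>i < n; j < n; p < P\<rbrakk> \<Longrightarrow> \<bar>f i j p u\<bar> \<le> F i j p"
    and g: "\<And>i j u. \<lbrakk>i < n; j < n\<rbrakk> \<Longrightarrow> \<bar>g i j u\<bar> \<le> G i j"
  shows "\<exists>B. \<forall>i<n. \<forall>k. \<bar>y i k\<bar> \<le> B"
proof -
  obtain B\<^sub>0 where B\<^sub>0: "\<And>i k. i < n \<Longrightarrow> k \<le> int \<sigma> \<Longrightarrow> \<bar>y i k\<bar> \<le> B\<^sub>0"
    using initial_bounded by blast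
  define K where "K i = (\<Sum>j<n. abs_sup (c i j) * G i j + (\<Sum>p<P. abs_sup (b i j p) * F i j p))
    + (\<Sum>m. \<bar>I i m\<bar>)" for i
  \<comment> \<open>The quotients are non-negative, so their sum dominates each of them; the first
    summand covers the initial history.\<close>
  define B where "B = \<bar>B\<^sub>0\<bar> + (\<Sum>i<n. K i / (1 - abs_sup (a i)))"
  have I_le: "\<bar>I i m\<bar> \<le> (\<Sum>m. \<bar>I i m\<bar>)" if "i < n" for i m
    using sum_le_suminf[OF I_summable[OF that], of "{m}"] by simp
  have K0: "0 \<le> K i" if "i < n" for i
    unfolding K_def using that
    by (intro add_nonneg_nonneg sum_nonneg mult_nonneg_nonneg suminf_nonneg I_summable abs_sup_nonneg
        b_Bseq c_Bseq less_imp_le[OF F_pos] less_imp_le[OF G_pos]) auto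
  have frac0: "0 \<le> K i / (1 - abs_sup (a i))" if "i < n" for i
    using K0[OF that] a_less_1[OF that] by simp
  have K_le: "K i \<le> (1 - abs_sup (a i)) * B" if "i < n" for i
  proof -
    have "K i / (1 - abs_sup (a i)) \<le> (\<Sum>i<n. K i / (1 - abs_sup (a i)))"
      using that frac0 by (intro member_le_sum) auto
    also have "\<dots> \<le> B" by (simp add: B_def)
    finally show ?thesis using a_less_1[OF that] by (simp add: pos_divide_le_eq mult.commute)
  qed
  have "\<forall>i<n. \<forall>k. \<bar>y i k\<bar> \<le> B"
  proof (rule history_induct[where V = "\<lambda>_ _. B"])
    fix i k assume "i < n" "k \<le> int \<sigma>"
    then have "\<bar>y i k\<bar> \<le> B\<^sub>0" by (rule B\<^sub>0)
    also have "\<dots> \<le> B" using frac0 by (auto simp: B_def intro!: add_increasing2 sum_nonneg)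
    finally show "\<bar>y i k\<bar> \<le> B" .
  next
    fix i m assume m: "\<sigma> \<le> m" and i: "i < n" and le: "\<And>j k. j < n \<Longrightarrow> k \<le> int m \<Longrightarrow> \<bar>y j k\<bar> \<le> B"
    have "\<bar>y i (int m + 1)\<bar> \<le> abs_sup (a i) * B
      + (\<Sum>j<n. abs_sup (c i j) * G i j + (\<Sum>p<P. abs_sup (b i j p) * F i j p)) + \<bar>I i m\<bar>"
      using m i by (intro abs_step_le le f g)
    also have "\<dots> \<le> abs_sup (a i) * B + K i" using I_le[OF i, of m] by (simp add: K_def)
    also have "\<dots> \<le> B" using K_le[OF i] by (simp add: left_diff_distrib)
    finally show "\<bar>y i (int m + 1)\<bar> \<le> B" .
  qed auto
  then show ?thesis by blast
qed

text \<open>The inequality for \<open>d\<close> lets a box with sides \<open>d i * R m\<close>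
  reproduce itself. The input enlarges the factor by \<open>E m\<close> in each step, and these
  increments are summable.\<close>

lemma bounded_if_pos_supersolution:
  assumes d: "\<And>i. i < n \<Longrightarrow> 0 < d i"
    and super: "\<And>i. i < n \<Longrightarrow> abs_sup (a i) * d i
      + (\<Sum>j<n. (abs_sup (c i j) * G i j + (\<Sum>p<P. abs_sup (b i j p) * F i j p)) * d j) \<le> d i"
  shows "\<exists>B. \<forall>i<n. \<forall>k. \<bar>y i k\<bar> \<le> B"
proof -
  obtain B\<^sub>0 where B\<^sub>0: "\<And>i k. i < n \<Longrightarrow> k \<le> int \<sigma> \<Longrightarrow> \<bar>y i k\<bar> \<le> B\<^sub>0"
    using initial_bounded by blast
  \<comment> \<open>\<open>W\<close> and \<open>E m\<close> are the scale factors at which the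
    multiples of \<open>d\<close> dominate the initial history and the input at time
    \<open>m\<close>; sums over the coordinates take the place of maxima.\<close>
  define W where "W = (\<Sum>i<n. \<bar>B\<^sub>0\<bar> / d i)"
  define E where "E m = (\<Sum>i<n. \<bar>I i m\<bar> / d i)" for m
  \<comment> \<open>The summation starts at 0 instead of \<sigma>; the additional terms are
    non-negative and only enlarge the bound.\<close>
  define R where "R m = W + (\<Sum>s<m. E s)" for m
  have E0: "0 \<le> E m" for m using d by (auto simp: E_def less_imp_le intro!: sum_nonneg)
  have W0: "0 \<le> W" using d by (auto simp: W_def less_imp_le intro!: sum_nonneg)
  have E_summable: "summable E"
    unfolding E_def by (intro summable_sum summable_divide I_summable) auto
  have R_mono: "R m \<le> R (Suc m)" for m using E0[of m] by (simp add: R_def)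
  have R0: "0 \<le> R m" for m using W0 E0 by (simp add: R_def sum_nonneg)
  have R_bound: "R m \<le> W + (\<Sum>s. E s)" for m
    using sum_le_suminf[OF E_summable, of "{..<m}"] E0 by (simp add: R_def)
  have dE: "\<bar>I i m\<bar> \<le> d i * E m" if "i < n" for i m
  proof -
    have "\<bar>I i m\<bar> / d i \<le> E m"
      unfolding E_def using that d by (intro member_le_sum) (auto simp: less_imp_le)
    then show ?thesis using d[OF that] by (simp add: pos_divide_le_eq mult.commute)
  qed
  have dW: "\<bar>B\<^sub>0\<bar> \<le> d i * W" if "i < n" for i
  proof -
    have "\<bar>B\<^sub>0\<bar> / d i \<le> W"
      unfolding W_def using that d by (intro member_le_sum[where f = "\<lambda>i. \<bar>B\<^sub>0\<bar> / d i"]) (auto simp: less_imp_le)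
    then show ?thesis using d[OF that] by (simp add: pos_divide_le_eq mult.commute)
  qed
  have "\<forall>i<n. \<forall>k. \<bar>y i k\<bar> \<le> (\<Sum>i<n. d i) * (W + (\<Sum>s. E s))"
  proof (rule history_induct[where V = "\<lambda>i m. d i * R m"])
    show "d i * R m \<le> d i * R (Suc m)" if "i < n" for i m
      using R_mono d[OF that] by (intro mult_left_mono) auto
    show "d i * R m \<le> (\<Sum>i<n. d i) * (W + (\<Sum>s. E s))" if "i < n" for i m
      using that R_bound R0 d by (intro mult_mono member_le_sum sum_nonneg) (auto simp: less_imp_le)
    show "\<bar>y i k\<bar> \<le> d i * R \<sigma>" if "i < n" "k \<le> int \<sigma>" for i k
    proof -
      have "\<bar>y i k\<bar> \<le> \<bar>B\<^sub>0\<bar>" using B\<^sub>0[OF that] by simp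
      also have "\<dots> \<le> d i * W" by (rule dW[OF that(1)])
      also have "\<dots> \<le> d i * R \<sigma>"
        using d[OF that(1)] E0 by (intro mult_left_mono) (auto simp: R_def sum_nonneg)
      finally show ?thesis .
    qed
    fix i m assume m: "\<sigma> \<le> m" and i: "i < n"
      and le: "\<And>j k. j < n \<Longrightarrow> k \<le> int m \<Longrightarrow> \<bar>y j k\<bar> \<le> d j * R m"
    have scaled: "\<bar>h (y j k)\<bar> \<le> K * (d j * R m)"
      if "sublinear h K" "0 < K" "j < n" "k \<le> int m" for h K j k
      using sublinear_le[OF that(1), of "y j k"] mult_left_mono[OF le[OF that(3,4)], of K] that(2) by linarith
    have "\<bar>y i (int m + 1)\<bar> \<le> abs_sup (a i) * (d i * R m)
      + (\<Sum>j<n. abs_sup (c i j) * (G i j * (d j * R m))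
          + (\<Sum>p<P. abs_sup (b i j p) * (F i j p * (d j * R m)))) + \<bar>I i m\<bar>"
      using m i by (intro abs_step_le le scaled f_sublinear g_sublinear F_pos G_pos)
    \<comment> \<open>All bounds are proportional to \<open>R m\<close>; factoring it out exposes
      the left-hand side of \<open>super\<close>.\<close>
    also have "\<dots> = (abs_sup (a i) * d i
      + (\<Sum>j<n. (abs_sup (c i j) * G i j + (\<Sum>p<P. abs_sup (b i j p) * F i j p)) * d j)) * R m + \<bar>I i m\<bar>"
      by (simp add: distrib_left distrib_right sum_distrib_left sum_distrib_right mult_ac)
    also have "\<dots> \<le> d i * R m + d i * E m"
      using super[OF i] R0 dE[OF i] by (intro add_mono mult_right_mono)
    also have "\<dots> = d i * R (Suc m)" by (simp add: R_def algebra_simps)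
    finally show "\<bar>y i (int m + 1)\<bar> \<le> d i * R (Suc m)" .
  qed
  then show ?thesis by blast
qed

text \<open>The coefficients enter only through asymptotic bounds \<alpha>, \<beta>, \<gamma>, which
  are upper limits in the first part and suprema in the second.\<close>

lemma tendsto_0_if_nonneg_minors:
  assumes bounded: "\<exists>B. \<forall>i<n. \<forall>k. \<bar>y i k\<bar> \<le> B"
    and \<alpha>: "\<And>i. i < n \<Longrightarrow> limsup_le (a i) (\<alpha> i)" "\<And>i. i < n \<Longrightarrow> \<alpha> i < 1"
    and \<beta>: "\<And>i j p. \<lbrakk>i < n; j < n; p < P\<rbrakk> \<Longrightarrow> limsup_le (b i j p) (\<beta> i j p)"
    and \<gamma>: "\<And>i j. \<lbrakk>i < n; j < n\<rbrakk> \<Longrightarrow> limsup_le (c i j) (\<gamma> i j)"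
    and minors: "\<And>T. T \<subseteq> {0..<n} \<Longrightarrow> 0 \<le> minor (\<lambda>i j. (if i = j then 1 - \<alpha> i else 0)
        - (\<gamma> i j * G i j + (\<Sum>p<P. \<beta> i j p * F i j p))) T"
    and i: "i < n"
  shows "(\<lambda>m. y i (int m)) \<longlonglongrightarrow> 0"
proof -
  obtain B where B: "\<And>i k. i < n \<Longrightarrow> \<bar>y i k\<bar> \<le> B" using bounded by blast
  let ?y = "\<lambda>i m. y i (int m)"
  have y_Bseq: "Bseq (?y i)" if "i < n" for i using B[OF that] by (intro BseqI') auto
  define L where "L i = abs_limsup (?y i)" for i
  define \<phi> where "\<phi> i j p = abs_limsup (\<lambda>m. f i j p (?y j m))" for i j p
  define \<psi> where "\<psi> i j = abs_limsup (\<lambda>m. g i j (?y j m))" for i j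
  have lim_y: "limsup_le (?y i) (L i)" if "i < n" for i
    unfolding L_def by (rule limsup_le_abs_limsup[OF y_Bseq[OF that]])
  have lim_f: "limsup_le (\<lambda>m. f i j p (?y j m)) (\<phi> i j p)" if "i < n" "j < n" "p < P" for i j p
    unfolding \<phi>_def
    by (rule limsup_le_abs_limsup[OF Bseq_sublinear[OF f_sublinear F_pos y_Bseq]]) (use that in auto)
  have lim_g: "limsup_le (\<lambda>m. g i j (?y j m)) (\<psi> i j)" if "i < n" "j < n" for i j
    unfolding \<psi>_def
    by (rule limsup_le_abs_limsup[OF Bseq_sublinear[OF g_sublinear G_pos y_Bseq]]) (use that in auto)
  have L0: "0 \<le> L i" if "i < n" for i by (rule limsup_le_nonneg[OF lim_y[OF that]])
  have \<phi>_le: "\<phi> i j p \<le> F i j p * L j" and \<phi>_less: "0 < L j \<Longrightarrow> \<phi> i j p < F i j p * L j"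
    if "i < n" "j < n" "p < P" for i j p
    unfolding \<phi>_def L_def using that
    by (auto intro!: abs_limsup_sublinear_le abs_limsup_sublinear_less f_sublinear F_pos y_Bseq)
  have \<psi>_le: "\<psi> i j \<le> G i j * L j" and \<psi>_less: "0 < L j \<Longrightarrow> \<psi> i j < G i j * L j"
    if "i < n" "j < n" for i j
    unfolding \<psi>_def L_def using that
    by (auto intro!: abs_limsup_sublinear_le abs_limsup_sublinear_less g_sublinear G_pos y_Bseq)
  have \<phi>0: "0 \<le> \<phi> i j p" if "i < n" "j < n" "p < P" for i j p
    by (rule limsup_le_nonneg[OF lim_f[OF that]])
  have \<psi>0: "0 \<le> \<psi> i j" if "i < n" "j < n" for i j
    by (rule limsup_le_nonneg[OF lim_g[OF that]])
  have \<beta>0: "0 \<le> \<beta> i j p" if "i < n" "j < n" "p < P" for i j p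
    by (rule limsup_le_nonneg[OF \<beta>[OF that]])
  have \<gamma>0: "0 \<le> \<gamma> i j" if "i < n" "j < n" for i j
    by (rule limsup_le_nonneg[OF \<gamma>[OF that]])
  \<comment> \<open>\<open>t i j\<close> bounds the asymptotic contribution of coordinate
    \<open>j\<close> to coordinate \<open>i\<close>; \<open>k i j * L j\<close> will be its linear
    majorant.\<close>
  define t where "t i j = \<gamma> i j * \<psi> i j + (\<Sum>p<P. \<beta> i j p * \<phi> i j p)" for i j
  define k where "k i j = \<gamma> i j * G i j + (\<Sum>p<P. \<beta> i j p * F i j p)" for i j
  have L_le: "L i \<le> \<alpha> i * L i + (\<Sum>j<n. t i j)" if i: "i < n" for i
  proof -
    \<comment> \<open>The bound is assembled term by term: point delays lead to late times, the
      distributed delay is a convolution of total absolute weight 1, and the summable input tends to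
      0.\<close>
    have "limsup_le (\<lambda>m. a i m * y i (int m - int (\<nu> i m))
     + (\<Sum>j<n. \<Sum>p<P. b i j p m * f i j p (y j (int m - int (\<tau> i j p m))))
     + (\<Sum>j<n. c i j m * (\<Sum>l. \<zeta> i j l * g i j (y j (int m - int l))))
     + I i m) (\<alpha> i * L i + (\<Sum>j<n. \<Sum>p<P. \<beta> i j p * \<phi> i j p) + (\<Sum>j<n. \<gamma> i j * \<psi> i j) + 0)"
    proof (intro limsup_le_add limsup_le_sum limsup_le_mult)
      show "limsup_le (\<lambda>m. y i (int m - int (\<nu> i m))) (L i)"
        by (rule limsup_le_delay[OF lim_y \<nu>_lim]) fact+
      show "limsup_le (I i) 0"
        unfolding limsup_le_0 using summable_LIMSEQ_zero[OF I_summable[OF i]] by (simp add: tendsto_rabs_zero_iff)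
      fix j assume "j \<in> {..<n}"
      then have j: "j < n" by simp
      show "limsup_le (\<lambda>m. f i j p (y j (int m - int (\<tau> i j p m)))) (\<phi> i j p)" if "p \<in> {..<P}" for p
        by (rule limsup_le_delay[where w = "\<lambda>k. f i j p (y j k)", OF lim_f \<tau>_lim]) (use that i j in auto)
      have "\<bar>g i j (y j k)\<bar> \<le> G i j * B" for k
        using sublinear_le[OF g_sublinear[OF i j], of "y j k"]
          mult_left_mono[OF B[OF j, of k], of "G i j"] G_pos[OF i j] by linarith
      then show "limsup_le (\<lambda>m. \<Sum>l. \<zeta> i j l * g i j (y j (int m - int l))) (\<psi> i j)"
        by (rule limsup_le_convolution[where w = "\<lambda>k. g i j (y j k)", OF \<zeta>_sums[OF i j] _ lim_g[OF i j]])
    qed (use i in \<open>auto intro: \<alpha> \<beta> \<gamma>\<close>)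
    then have "limsup_le (\<lambda>m. ?y i (Suc m))
      (\<alpha> i * L i + (\<Sum>j<n. \<Sum>p<P. \<beta> i j p * \<phi> i j p) + (\<Sum>j<n. \<gamma> i j * \<psi> i j) + 0)"
    \<comment> \<open>The recursion is available only from time \<sigma> on, hence an eventual
      equality.\<close>
    proof (rule limsup_le_eventually_cong)
      show "\<forall>\<^sub>F m in sequentially. ?y i (Suc m) = a i m * y i (int m - int (\<nu> i m))
       + (\<Sum>j<n. \<Sum>p<P. b i j p m * f i j p (y j (int m - int (\<tau> i j p m))))
       + (\<Sum>j<n. c i j m * (\<Sum>l. \<zeta> i j l * g i j (y j (int m - int l))))
       + I i m"
        using eventually_ge_at_top[of \<sigma>]
      proof eventually_elim
        case (elim m)
        then show ?case using step[OF elim i] by (simp add: add.commute)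
      qed
    qed
    then have "limsup_le (?y i) (\<alpha> i * L i + (\<Sum>j<n. \<Sum>p<P. \<beta> i j p * \<phi> i j p) + (\<Sum>j<n. \<gamma> i j * \<psi> i j) + 0)"
      by (rule limsup_le_shift)
    then have "L i \<le> \<alpha> i * L i + (\<Sum>j<n. \<Sum>p<P. \<beta> i j p * \<phi> i j p) + (\<Sum>j<n. \<gamma> i j * \<psi> i j) + 0"
      by (simp only: limsup_le_iff_abs_limsup[OF y_Bseq[OF i]] flip: L_def)
    then show ?thesis by (simp add: t_def sum.distrib)
  qed
  have t_le: "t i j \<le> k i j * L j" if "i < n" "j < n" for i j
  proof -
    have "t i j \<le> \<gamma> i j * (G i j * L j) + (\<Sum>p<P. \<beta> i j p * (F i j p * L j))"
      unfolding t_def using that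
      by (intro add_mono sum_mono mult_left_mono \<phi>_le \<psi>_le \<beta>0 \<gamma>0) auto
    then show ?thesis by (simp add: k_def distrib_right sum_distrib_right mult.assoc)
  qed
  \<comment> \<open>A positive \<open>t i j\<close> forces a positive coefficient \<gamma> or
    \<beta>, and the term carrying it inherits the strict inequality of its nonlinearity.\<close>
  have t_less: "t i j < k i j * L j" if ij: "i < n" "j < n" and Lj: "0 < L j" and t: "0 < t i j" for i j
  proof -
    have "t i j < \<gamma> i j * (G i j * L j) + (\<Sum>p<P. \<beta> i j p * (F i j p * L j))"
    proof (cases "\<gamma> i j = 0")
      case True
      have "\<exists>p<P. \<beta> i j p \<noteq> 0"
      proof (rule ccontr)
        assume "\<not> ?thesis"
        then have "t i j = 0" using True by (simp add: t_def)
        with t show False by simp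
      qed
      then obtain q where q: "q < P" "\<beta> i j q \<noteq> 0" by blast
      then have "0 < \<beta> i j q" using \<beta>0[OF ij] by (simp add: less_le)
      then have "(\<Sum>p<P. \<beta> i j p * \<phi> i j p) < (\<Sum>p<P. \<beta> i j p * (F i j p * L j))"
        using ij q Lj
        by (intro sum_strict_mono_ex1) (auto intro!: mult_left_mono \<phi>_le \<beta>0 bexI[of _ q] \<phi>_less)
      then show ?thesis using True by (simp add: t_def)
    next
      case False
      then have "0 < \<gamma> i j" using \<gamma>0[OF ij] by simp
      then have "\<gamma> i j * \<psi> i j < \<gamma> i j * (G i j * L j)" using \<psi>_less[OF ij Lj] by simp
      moreover have "(\<Sum>p<P. \<beta> i j p * \<phi> i j p) \<le> (\<Sum>p<P. \<beta> i j p * (F i j p * L j))"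
        using ij by (intro sum_mono mult_left_mono \<phi>_le \<beta>0) auto
      ultimately show ?thesis by (simp add: t_def)
    qed
    then show ?thesis by (simp add: k_def distrib_right sum_distrib_right mult.assoc)
  qed
  define S where "S = {i. i < n \<and> 0 < L i}"
  have S: "finite S" "S \<subseteq> {0..<n}" by (auto simp: S_def)
  \<comment> \<open>Outside \<open>S\<close> the upper limit \<open>L j\<close> is 0, so these
    columns contribute nothing positive.\<close>
  have sum_S: "(\<Sum>j<n. t i j) \<le> (\<Sum>j\<in>S. t i j)" if "i < n" for i
  proof -
    have "(\<Sum>j<n. t i j) = (\<Sum>j\<in>{..<n} - S. t i j) + (\<Sum>j\<in>S. t i j)"
      by (rule sum.subset_diff) (auto simp: S_def)
    moreover have "t i j \<le> 0" if "j \<in> {..<n} - S" for j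
    proof -
      have "j < n" "L j = 0" using that L0[of j] by (auto simp: S_def)
      then show ?thesis using t_le[OF \<open>i < n\<close>, of j] by simp
    qed
    then have "(\<Sum>j\<in>{..<n} - S. t i j) \<le> 0" by (rule sum_nonpos)
    ultimately show ?thesis by linarith
  qed
  \<comment> \<open>Since \<open>\<alpha> i < 1\<close>, the positive quantity
    \<open>(1 - \<alpha> i) * L i\<close> is bounded by the sum of the \<open>t i j\<close>; one of
    these is therefore positive, and its column makes the comparison with \<open>k i j * L j\<close>
    strict.\<close>
  have strict: "(\<Sum>j\<in>S. ((if i = j then 1 - \<alpha> i else 0) - k i j) * L j) < 0" if iS: "i \<in> S" for i
  proof -
    have i: "i < n" and Li: "0 < L i" using iS by (auto simp: S_def)
    have "0 < (1 - \<alpha> i) * L i" using \<alpha>(2)[OF i] Li by simp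
    moreover have le: "(1 - \<alpha> i) * L i \<le> (\<Sum>j\<in>S. t i j)"
      using L_le[OF i] sum_S[OF i] by (simp add: left_diff_distrib)
    ultimately have "0 < (\<Sum>j\<in>S. t i j)" by linarith
    then obtain j where j: "j \<in> S" "0 < t i j" by (meson sum_nonpos not_le)
    have "(\<Sum>j\<in>S. t i j) < (\<Sum>j\<in>S. k i j * L j)"
      using j i S(1) by (intro sum_strict_mono_ex1) (auto intro!: t_le t_less bexI[of _ j] simp: S_def)
    with le have "(1 - \<alpha> i) * L i < (\<Sum>j\<in>S. k i j * L j)" by linarith
    moreover have "(\<Sum>j\<in>S. ((if i = j then 1 - \<alpha> i else 0) - k i j) * L j)
      = (\<Sum>j\<in>S. (if i = j then (1 - \<alpha> i) * L i else 0)) - (\<Sum>j\<in>S. k i j * L j)"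
      unfolding sum_subtractf[symmetric] by (intro sum.cong) (auto simp: left_diff_distrib)
    ultimately show ?thesis using iS S(1) by simp
  qed
  have "S = {}"
  proof (rule ccontr)
    assume "S \<noteq> {}"
    have "\<exists>i\<in>S. 0 \<le> (\<Sum>j\<in>S. ((if i = j then 1 - \<alpha> i else 0) - k i j) * L j)"
    proof (rule nonneg_minors_no_sign_reversal[OF S(1) \<open>S \<noteq> {}\<close>])
      show "0 \<le> minor (\<lambda>i j. (if i = j then 1 - \<alpha> i else 0) - k i j) T" if "T \<subseteq> S" for T
        unfolding k_def by (rule minors) (use that S(2) in auto)
    qed (simp add: S_def)
    with strict show False by force
  qed
  then have "L i = 0" using i L0[OF i] by (force simp: S_def)
  then show ?thesis using lim_y[OF i] limsup_le_0 by metis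
qed

end

section \<open>Passage between matrices and vectors and their coordinate families\<close>

lemma M_matrix_minor_nonneg:
  assumes "A \<in> carrier_mat n n" "M_matrix A" "T \<subseteq> {0..<n}"
  shows "0 \<le> minor (\<lambda>i j. A $$ (i, j)) T"
\<comment> \<open>\<open>M_matrix\<close> constrains non-empty index sets; the empty minor equals
  1.\<close>
proof (cases "T = {}")
  case False
  have "0 \<le> det (submatrix A T T)"
    using assms(2,3) False unfolding M_matrix_def carrier_matD(1)[OF assms(1)] by blast
  then show ?thesis by (simp only: det_submatrix_eq_minor[OF assms(1,3)])
qed simp

text \<open>Finitely many coordinates become small simultaneously; \<open>0 < n\<close> makes the
  maximum range over a non-empty set.\<close>

lemma tendsto_max_norm_0:
  fixes x :: "int \<Rightarrow> real vec"
  assumes "0 < n" and x: "\<And>k. x k \<in> carrier_vec n"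
    and lim: "\<And>i. i < n \<Longrightarrow> (\<lambda>m. x (int m) $ i) \<longlonglongrightarrow> 0"
  shows "((\<lambda>k. max_norm (x k)) \<longlongrightarrow> 0) at_top"
proof (rule tendstoI)
  fix e :: real assume "0 < e"
  have "\<forall>\<^sub>F m in sequentially. \<forall>i\<in>{0..<n}. \<bar>x (int m) $ i\<bar> < e"
    using tendstoD[OF lim \<open>0 < e\<close>] by (intro eventually_ball_finite) (auto simp: dist_real_def)
  then have "\<forall>\<^sub>F k in at_top. \<forall>i\<in>{0..<n}. \<bar>x k $ i\<bar> < e" by (rule eventually_nat_imp_int)
  then show "\<forall>\<^sub>F k in at_top. dist (max_norm (x k)) 0 < e"
  proof eventually_elim
    case (elim k)
    let ?A = "(\<lambda>i. \<bar>x k $ i\<bar>) ` {0..<n}"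
    have "max_norm (x k) = Max ?A" using carrier_vecD[OF x[of k]] by (simp add: max_norm_def)
    moreover have "Max ?A < e" using elim \<open>0 < n\<close> by (subst Max_less_iff) auto
    moreover have "\<bar>x k $ 0\<bar> \<le> Max ?A" using \<open>0 < n\<close> by (intro Max_ge) auto
    then have "0 \<le> Max ?A" by (rule order_trans[OF abs_ge_zero])
    ultimately show ?case by (simp add: dist_real_def)
  qed
qed

lemma bounded_initial_component:
  assumes "\<psi> \<in> bounded_initial n"
  shows "\<exists>B. \<forall>i<n. \<forall>s\<le>0. \<bar>\<psi> s $ i\<bar> \<le> B"
proof -
  obtain B where B: "\<And>s. s \<le> 0 \<Longrightarrow> max_norm (\<psi> s) \<le> B"
    using assms by (auto simp: bounded_initial_def bdd_above_def)
  have "\<bar>\<psi> s $ i\<bar> \<le> B" if "i < n" "s \<le> 0" for i s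
  proof -
    have "dim_vec (\<psi> s) = n" using assms that(2) by (auto simp: bounded_initial_def)
    then have "\<bar>\<psi> s $ i\<bar> \<le> max_norm (\<psi> s)"
      unfolding max_norm_def using that(1) by (intro Max_ge) auto
    with B[OF that(2)] show ?thesis by linarith
  qed
  then show ?thesis by blast
qed

theorem theorem3p4:
  fixes n P :: nat
    and a :: "nat \<Rightarrow> nat \<Rightarrow> real"
    and \<nu> :: "nat \<Rightarrow> nat \<Rightarrow> nat"
    and b :: "nat \<Rightarrow> nat \<Rightarrow> nat \<Rightarrow> nat \<Rightarrow> real"
    and \<tau> :: "nat \<Rightarrow> nat \<Rightarrow> nat \<Rightarrow> nat \<Rightarrow> nat"
    and f :: "nat \<Rightarrow> nat \<Rightarrow> nat \<Rightarrow> real \<Rightarrow> real"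
    and c :: "nat \<Rightarrow> nat \<Rightarrow> nat \<Rightarrow> real"
    and \<zeta> :: "nat \<Rightarrow> nat \<Rightarrow> nat \<Rightarrow> real"
    and g :: "nat \<Rightarrow> nat \<Rightarrow> real \<Rightarrow> real"
    and I :: "nat \<Rightarrow> nat \<Rightarrow> real"
    and F :: "nat \<Rightarrow> nat \<Rightarrow> nat \<Rightarrow> real"
    and G :: "nat \<Rightarrow> nat \<Rightarrow> real"
  assumes "n > 0" and "P > 0"
    and a_range: "\<And>i m. i < n \<Longrightarrow> -1 < a i m \<and> a i m < 1"
    and H1: "\<And>i. i < n \<Longrightarrow> abs_sup (a i) < 1"
    and H2_\<nu>: "\<And>i. i < n \<Longrightarrow> filterlim (\<lambda>m. int m - int (\<nu> i m)) at_top at_top"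
    and H2_\<tau>: "\<And>i j p. \<lbrakk>i < n; j < n; p < P\<rbrakk> \<Longrightarrow>
                  filterlim (\<lambda>m. int m - int (\<tau> i j p m)) at_top at_top"
    and H3_b: "\<And>i j p. \<lbrakk>i < n; j < n; p < P\<rbrakk> \<Longrightarrow> Bseq (b i j p)"
    and H3_c: "\<And>i j. \<lbrakk>i < n; j < n\<rbrakk> \<Longrightarrow> Bseq (c i j)"
    and H4: "\<And>i j. \<lbrakk>i < n; j < n\<rbrakk> \<Longrightarrow> (\<lambda>l. \<bar>\<zeta> i j l\<bar>) sums 1"
    and H5: "\<And>i. i < n \<Longrightarrow> summable (\<lambda>m. \<bar>I i m\<bar>)"
    and F_pos: "\<And>i j p. \<lbrakk>i < n; j < n; p < P\<rbrakk> \<Longrightarrow> F i j p > 0"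
    and G_pos: "\<And>i j. \<lbrakk>i < n; j < n\<rbrakk> \<Longrightarrow> G i j > 0"
  shows
    "((\<forall>i<n. \<forall>j<n. (\<forall>p<P. sublinear_capped (f i j p) (F i j p)) \<and> sublinear_capped (g i j) (G i j)) \<and>
      M_matrix (mat_diag n (\<lambda>i. 1 - abs_limsup (a i))
                - mat n n (\<lambda>(i, j). abs_limsup (c i j) * G i j
                                     + (\<Sum>p<P. abs_limsup (b i j p) * F i j p)))
      \<longrightarrow> (\<forall>\<sigma>. \<forall>\<psi> \<in> bounded_initial n. \<forall>x. is_solution n P a \<nu> b \<tau> f c \<zeta> g I \<sigma> \<psi> x \<longrightarrow>
             ((\<lambda>m. max_norm (x m)) \<longlongrightarrow> 0) at_top))
     \<and>
     ((\<forall>i<n. \<forall>j<n. (\<forall>p<P. sublinear (f i j p) (F i j p)) \<and> sublinear (g i j) (G i j)) \<and>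
      (let M = mat_diag n (\<lambda>i. 1 - abs_sup (a i))
               - mat n n (\<lambda>(i, j). abs_sup (c i j) * G i j
                                    + (\<Sum>p<P. abs_sup (b i j p) * F i j p))
       in M_matrix M \<and> singular_matrix M \<and> irreducible_matrix M)
      \<longrightarrow> (\<forall>\<sigma>. \<forall>\<psi> \<in> bounded_initial n. \<forall>x. is_solution n P a \<nu> b \<tau> f c \<zeta> g I \<sigma> \<psi> x \<longrightarrow>
             ((\<lambda>m. max_norm (x m)) \<longlongrightarrow> 0) at_top))"
proof -
  have a_Bseq: "Bseq (a i)" if "i < n" for i
    using a_range[OF that] by (intro BseqI'[of _ 1]) (auto simp: abs_le_iff less_imp_le minus_less_iff)
  have system: "delay_system n P a \<nu> b \<tau> f c \<zeta> g I F G \<sigma> (\<lambda>i k. x k $ i)"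
    if sub: "\<forall>i<n. \<forall>j<n. (\<forall>p<P. sublinear (f i j p) (F i j p)) \<and> sublinear (g i j) (G i j)"
      and \<psi>: "\<psi> \<in> bounded_initial n" and sol: "is_solution n P a \<nu> b \<tau> f c \<zeta> g I \<sigma> \<psi> x" for \<sigma> \<psi> x
  proof
    obtain B where B: "\<forall>i<n. \<forall>s\<le>0. \<bar>\<psi> s $ i\<bar> \<le> B" using bounded_initial_component[OF \<psi>] ..
    have "\<bar>x k $ i\<bar> \<le> B" if "i < n" "k \<le> int \<sigma>" for i k
    proof -
      have s: "k - int \<sigma> \<le> 0" using that(2) by simp
      then have "x (int \<sigma> + (k - int \<sigma>)) = \<psi> (k - int \<sigma>)" using sol unfolding is_solution_def by blast
      then have "x k = \<psi> (k - int \<sigma>)" by simp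
      then show ?thesis using B that(1) s by simp
    qed
    then show "\<exists>B. \<forall>i<n. \<forall>k\<le>int \<sigma>. \<bar>x k $ i\<bar> \<le> B" by blast
  next
    fix m i assume "\<sigma> \<le> m" "i < n"
    then have "x (int m + 1) $ i = system_rhs n P a \<nu> b \<tau> f c \<zeta> g I x m i"
      using sol unfolding is_solution_def by blast
    then show "x (int m + 1) $ i = a i m * x (int m - int (\<nu> i m)) $ i
       + (\<Sum>j<n. \<Sum>p<P. b i j p m * f i j p (x (int m - int (\<tau> i j p m)) $ j))
       + (\<Sum>j<n. c i j m * (\<Sum>l. \<zeta> i j l * g i j (x (int m - int l) $ j))) + I i m"
      by (simp only: system_rhs_def)
  qed (use a_Bseq H1 H2_\<nu> H2_\<tau> H3_b H3_c H4 H5 F_pos G_pos sub in simp_all)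
  \<comment> \<open>Stated for arbitrary \<alpha> and \<open>k\<close>, this turns the M-matrix
    hypothesis of either part into the form that the convergence lemma expects.\<close>
  have minors: "0 \<le> minor (\<lambda>i j. (if i = j then 1 - \<alpha> i else 0) - k i j) T"
    if "M_matrix (mat_diag n (\<lambda>i. 1 - \<alpha> i) - mat n n (\<lambda>(i, j). k i j))" "T \<subseteq> {0..<n}" for \<alpha> k T
  proof -
    have "minor (\<lambda>i j. (if i = j then 1 - \<alpha> i else 0) - k i j) T
      = minor (\<lambda>i j. (mat_diag n (\<lambda>i. 1 - \<alpha> i) - mat n n (\<lambda>(i, j). k i j)) $$ (i, j)) T"
      using that(2) by (intro minor_cong) (auto simp: mat_diag_def subset_iff)
    also have "\<dots> \<ge> 0" by (rule M_matrix_minor_nonneg[OF _ that]) (intro minus_carrier_mat mat_carrier)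
    finally show ?thesis .
  qed
  show ?thesis
  proof (intro conjI impI allI ballI; elim conjE)
    fix \<sigma> \<psi> x
    assume cap: "\<forall>i<n. \<forall>j<n. (\<forall>p<P. sublinear_capped (f i j p) (F i j p)) \<and> sublinear_capped (g i j) (G i j)"
      and M: "M_matrix (mat_diag n (\<lambda>i. 1 - abs_limsup (a i))
                - mat n n (\<lambda>(i, j). abs_limsup (c i j) * G i j + (\<Sum>p<P. abs_limsup (b i j p) * F i j p)))"
      and \<psi>: "\<psi> \<in> bounded_initial n" and sol: "is_solution n P a \<nu> b \<tau> f c \<zeta> g I \<sigma> \<psi> x"
    have cap_f: "sublinear_capped (f i j p) (F i j p)" if "i < n" "j < n" "p < P" for i j p
      using cap that by simp
    have cap_g: "sublinear_capped (g i j) (G i j)" if "i < n" "j < n" for i j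
      using cap that by simp
    interpret delay_system n P a \<nu> b \<tau> f c \<zeta> g I F G \<sigma> "\<lambda>i k. x k $ i"
    proof (rule system[OF _ \<psi> sol], intro allI impI conjI)
      show "sublinear (f i j p) (F i j p)" if "i < n" "j < n" "p < P" for i j p
        by (rule sublinear_capped_imp_sublinear[OF cap_f[OF that] F_pos[OF that]])
      show "sublinear (g i j) (G i j)" if "i < n" "j < n" for i j
        by (rule sublinear_capped_imp_sublinear[OF cap_g[OF that] G_pos[OF that]])
    qed
    have bounded: "\<exists>B. \<forall>i<n. \<forall>k. \<bar>x k $ i\<bar> \<le> B"
    proof (rule bounded_if_nonlinearities_bounded)
      show "\<bar>f i j p u\<bar> \<le> F i j p" if "i < n" "j < n" "p < P" for i j p u
        by (rule sublinear_capped_le[OF cap_f[OF that] F_pos[OF that]])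
      show "\<bar>g i j u\<bar> \<le> G i j" if "i < n" "j < n" for i j u
        by (rule sublinear_capped_le[OF cap_g[OF that] G_pos[OF that]])
    qed
    \<comment> \<open>The upper limit is at most the supremum, which (H1) puts below 1.\<close>
    have a_lim: "abs_limsup (a i) < 1" if "i < n" for i
      using limsup_le_abs_sup(2)[OF a_Bseq[OF that]] H1[OF that]
      unfolding limsup_le_iff_abs_limsup[OF a_Bseq[OF that]] by linarith
    show "((\<lambda>k. max_norm (x k)) \<longlongrightarrow> 0) at_top"
    proof (rule tendsto_max_norm_0[OF \<open>n > 0\<close>])
      show "x k \<in> carrier_vec n" for k using sol unfolding is_solution_def by blast
      show "(\<lambda>m. x (int m) $ i) \<longlonglongrightarrow> 0" if "i < n" for i
        by (rule tendsto_0_if_nonneg_minors[OF bounded limsup_le_abs_limsup a_lim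
              limsup_le_abs_limsup limsup_le_abs_limsup minors[OF M] that])
          (use a_Bseq H3_b H3_c in auto)
    qed
  next
    fix \<sigma> \<psi> x
    let ?k = "\<lambda>i j. abs_sup (c i j) * G i j + (\<Sum>p<P. abs_sup (b i j p) * F i j p)"
    let ?M = "mat_diag n (\<lambda>i. 1 - abs_sup (a i)) - mat n n (\<lambda>(i, j). ?k i j)"
    assume sub: "\<forall>i<n. \<forall>j<n. (\<forall>p<P. sublinear (f i j p) (F i j p)) \<and> sublinear (g i j) (G i j)"
      and "let M = ?M in M_matrix M \<and> singular_matrix M \<and> irreducible_matrix M"
      and \<psi>: "\<psi> \<in> bounded_initial n" and sol: "is_solution n P a \<nu> b \<tau> f c \<zeta> g I \<sigma> \<psi> x"
    then have M: "M_matrix ?M" and irred: "irreducible_matrix ?M" by (simp_all only: Let_def)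
    interpret delay_system n P a \<nu> b \<tau> f c \<zeta> g I F G \<sigma> "\<lambda>i k. x k $ i"
      by (rule system[OF sub \<psi> sol])
    define A where "A = ?M"
    have A_carrier: "A \<in> carrier_mat n n" unfolding A_def by (intro minus_carrier_mat mat_carrier)
    have A_entry: "A $$ (i, j) = (if i = j then 1 - abs_sup (a i) else 0) - ?k i j"
      if "i < n" "j < n" for i j
      using that by (simp add: A_def mat_diag_def)
    have A_M: "M_matrix A" and A_irred: "\<not> reducible_matrix A"
      using M irred unfolding A_def irreducible_matrix_def by blast+
    have "\<exists>d. \<forall>i<n. 0 < d i \<and> 0 \<le> (\<Sum>j<n. A $$ (i, j) * d j)"
    proof (rule Z_irreducible_pos_vector[OF \<open>n > 0\<close>])
      show "A $$ (i, j) \<le> 0" if "i < n" "j < n" "i \<noteq> j" for i j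
        using A_M that by (simp add: M_matrix_def Z_matrix_def carrier_matD[OF A_carrier])
      show "0 \<le> minor (\<lambda>i j. A $$ (i, j)) T" if "T \<subseteq> {0..<n}" for T
        by (rule M_matrix_minor_nonneg[OF A_carrier A_M that])
      show "\<exists>i\<in>S. \<exists>j\<in>{0..<n} - S. A $$ (i, j) \<noteq> 0" if "S \<subset> {0..<n}" "S \<noteq> {}" for S
        using reducible_matrix_if_zero_block[OF A_carrier that] A_irred by blast
    qed
    then obtain d where dA: "\<forall>i<n. 0 < d i \<and> 0 \<le> (\<Sum>j<n. A $$ (i, j) * d j)" by (elim exE)
    have bounded: "\<exists>B. \<forall>i<n. \<forall>k. \<bar>x k $ i\<bar> \<le> B"
    proof (rule bounded_if_pos_supersolution)
      show "0 < d i" if "i < n" for i using dA that by simp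
      fix i assume i: "i < n"
      \<comment> \<open>Row \<open>i\<close> of \<open>A\<close> applied to \<open>d\<close> becomes
        the supersolution inequality once the contribution of \<open>1 - abs_sup (a i)\<close> is
        split off.\<close>
      have "0 \<le> (\<Sum>j<n. A $$ (i, j) * d j)" using dA i by simp
      also have "\<dots> = (\<Sum>j<n. (if i = j then (1 - abs_sup (a i)) * d i else 0) - ?k i j * d j)"
        using A_entry[OF i] by (intro sum.cong) (auto simp: left_diff_distrib)
      also have "\<dots> = (1 - abs_sup (a i)) * d i - (\<Sum>j<n. ?k i j * d j)"
        unfolding sum_subtractf using i by simp
      finally show "abs_sup (a i) * d i + (\<Sum>j<n. ?k i j * d j) \<le> d i"
        by (simp add: left_diff_distrib)
    qed
    show "((\<lambda>k. max_norm (x k)) \<longlongrightarrow> 0) at_top"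
    proof (rule tendsto_max_norm_0[OF \<open>n > 0\<close>])
      show "x k \<in> carrier_vec n" for k using sol unfolding is_solution_def by blast
      show "(\<lambda>m. x (int m) $ i) \<longlonglongrightarrow> 0" if "i < n" for i
        by (rule tendsto_0_if_nonneg_minors[OF bounded limsup_le_abs_sup(2) H1
              limsup_le_abs_sup(2) limsup_le_abs_sup(2) minors[OF M] that])
          (use a_Bseq H3_b H3_c in auto)
    qed
  qed
qed

end
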